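(* Let $n,\ell$ be two positive integers. Let $A$ be the set of hook permutations $(H,\sigma)$ of size $n$ and length $\ell$, regarded as a signed set all of whose elements are positive. Let $B$ be the set of pairs $(P,Q)$ of ribbon tableaux of size $n$ and length $\ell$ having the same shape, regarded as a signed set with sign $\varepsilon(P)\varepsilon(Q)$. Then there exists a signed bijection $(\mathrm{Id},i,\phi)$ between $A$ and $B$, i.e. there exist an involution $i:B\to B$ which reverses signs outside of its fixed point set $\mathrm{Fix}(i)$, and a sign preserving bijection $\phi:A\to \mathrm{Fix}(i)$. Moreover, $i$ and $\phi$ can be chosen so that contents are preserved, in the following sense: if $i(P,Q)=(P_1,Q_1)$, then $c(P)=c(P_1)$ and $c(Q)=c(Q_1)$; and if $\phi(H,\sigma)=(P,Q)$, then $c(H)=c(Q)$ and $c(H,\sigma)=c(P)$.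
   Context: Partitions are identified with their Ferrers diagrams (left-justified sets of cells, the $i$th row from the top having $\lambda_i$ cells); $|\lambda|$ is the number of cells. For $\lambda\subseteq\mu$, the skew shape $\mu/\lambda$ is identified with the set of cells $\mu\setminus\lambda$, and its size $|\mu/\lambda|$ is its number of cells. A ribbon is a connected skew shape (any two cells are joined by a sequence of its cells in which consecutive cells share a side) containing no $2\times 2$ square of cells. The height $h(r)$ of a nonempty ribbon $r$ is the number of rows it occupies minus one, and its sign is $\varepsilon(r)=(-1)^{h(r)}$. A ribbon tableau of shape $\lambda$ and length $\ell$ is a sequence of partitions $\emptyset=\lambda^0\subset\lambda^1\subset\cdots\subset\lambda^\ell=\lambda$ such that each $r_i=\lambda^{i+1}/\lambda^i$ ($0\le i<\ell$) is a nonempty ribbon. Its size is $|\lambda|$; its sign $\varepsilon(P)$ is the product of the signs of the ribbons $r_i$; its content $c(P)$ is the composition $(|r_0|,\ldots,|r_{\ell-1}|)$ of $|\lambda|$. A hook is a nonempty partition of the form $(k,1,\ldots,1)$; it is characterized by its size $s\geq 1$ and its height $h\in\{0,\ldots,s-1\}$ (number of rows minus one). A hook permutation of length $\ell$ is a pair $(H,\sigma)$ where $H=(H_1,\ldots,H_\ell)$ is a sequence of $\ell$ hooks and $\sigma$ is a permutation of $\{1,\ldots,\ell\}$; its size is $\sum_i|H_i|$. Put $c(H)=(|H_1|,\ldots,|H_\ell|)$ and $c(H,\sigma)=(|H_{\sigma(1)}|,\ldots,|H_{\sigma(\ell)}|)$. A signed set is a finite set together with a function to $\{1,-1\}$ (its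 sign). A signed bijection between signed sets $A$ and $B$ is a triple $(i_A,i_B,\phi)$ where $i_A$ (resp. $i_B$) is an involution on $A$ (resp. $B$) that is sign reversing outside its fixed point set, and $\phi$ is a sign preserving bijection from $\mathrm{Fix}(i_A)$ to $\mathrm{Fix}(i_B)$. *)

theory Defs
  imports Main "HOL-Combinatorics.Permutations"
begin

text \<open>Partitions are weakly decreasing lists of positive parts; the empty list is the
  empty partition. The cell \<open>(i, j)\<close> is in row \<open>i\<close> (from the top) and column \<open>j\<close> (from
  the left), both counted from 0.\<close>

definition is_partition :: "nat list \<Rightarrow> bool" where
  "is_partition lam \<longleftrightarrow> sorted_wrt (\<ge>) lam \<and> (\<forall>k\<in>set lam. k > 0)"

definition diagram :: "nat list \<Rightarrow> (nat \<times> nat) set" where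
  "diagram lam = {(i, j). i < length lam \<and> j < lam ! i}"

definition psize :: "nat list \<Rightarrow> nat" where
  "psize lam = card (diagram lam)"

definition skew :: "nat list \<Rightarrow> nat list \<Rightarrow> (nat \<times> nat) set" where
  "skew mu lam = diagram mu - diagram lam"

definition skew_shape :: "(nat \<times> nat) set \<Rightarrow> bool" where
  "skew_shape S \<longleftrightarrow> (\<exists>lam mu. is_partition lam \<and> is_partition mu
     \<and> diagram lam \<subseteq> diagram mu \<and> S = skew mu lam)"

definition share_side :: "nat \<times> nat \<Rightarrow> nat \<times> nat \<Rightarrow> bool" where
  "share_side c d \<longleftrightarrow>
     (fst c = fst d \<and> (snd c = Suc (snd d) \<or> snd d = Suc (snd c)))
   \<or> (snd c = snd d \<and> (fst c = Suc (fst d) \<or> fst d = Suc (fst c)))"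

definition connected_cells :: "(nat \<times> nat) set \<Rightarrow> bool" where
  "connected_cells S \<longleftrightarrow>
     (\<forall>c\<in>S. \<forall>d\<in>S. (c, d) \<in> {(a, b). a \<in> S \<and> b \<in> S \<and> share_side a b}\<^sup>*)"

definition has_square :: "(nat \<times> nat) set \<Rightarrow> bool" where
  "has_square S \<longleftrightarrow> (\<exists>i j. {(i, j), (i, Suc j), (Suc i, j), (Suc i, Suc j)} \<subseteq> S)"

definition ribbon :: "(nat \<times> nat) set \<Rightarrow> bool" where
  "ribbon S \<longleftrightarrow> skew_shape S \<and> connected_cells S \<and> \<not> has_square S"

text \<open>The height is only meaningful for nonempty ribbons, where the subtraction does
  not truncate.\<close>

definition ribbon_height :: "(nat \<times> nat) set \<Rightarrow> nat" where
  "ribbon_height S = card (fst ` S) - 1"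

definition ribbon_sign :: "(nat \<times> nat) set \<Rightarrow> int" where
  "ribbon_sign S = (-1) ^ ribbon_height S"

text \<open>A ribbon tableau of length \<open>l\<close> is the list \<open>P\<close> of its \<open>l + 1\<close> partitions.\<close>

definition ribbon_tableau :: "nat list list \<Rightarrow> nat list \<Rightarrow> nat \<Rightarrow> bool" where
  "ribbon_tableau P lam l \<longleftrightarrow>
     length P = Suc l \<and> P ! 0 = [] \<and> P ! l = lam
   \<and> (\<forall>i\<le>l. is_partition (P ! i))
   \<and> (\<forall>i<l. diagram (P ! i) \<subset> diagram (P ! Suc i)
          \<and> skew (P ! Suc i) (P ! i) \<noteq> {}
          \<and> ribbon (skew (P ! Suc i) (P ! i)))"

definition tableau_ribbon :: "nat list list \<Rightarrow> nat \<Rightarrow> (nat \<times> nat) set" where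
  "tableau_ribbon P i = skew (P ! Suc i) (P ! i)"

definition tableau_sign :: "nat list list \<Rightarrow> int" where
  "tableau_sign P = (\<Prod>i<length P - 1. ribbon_sign (tableau_ribbon P i))"

definition tableau_content :: "nat list list \<Rightarrow> nat list" where
  "tableau_content P = map (\<lambda>i. card (tableau_ribbon P i)) [0..<length P - 1]"

definition tableau_pairs :: "nat \<Rightarrow> nat \<Rightarrow> (nat list list \<times> nat list list) set" where
  "tableau_pairs n l =
     {(P, Q). \<exists>lam. psize lam = n \<and> ribbon_tableau P lam l \<and> ribbon_tableau Q lam l}"

definition pair_sign :: "nat list list \<times> nat list list \<Rightarrow> int" where
  "pair_sign PQ = tableau_sign (fst PQ) * tableau_sign (snd PQ)"

definition is_hook :: "nat list \<Rightarrow> bool" where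
  "is_hook lam \<longleftrightarrow> (\<exists>k m. k \<ge> 1 \<and> lam = k # replicate m 1)"

definition hook_content :: "nat list list \<Rightarrow> nat list" where
  "hook_content H = map psize H"

text \<open>Permutations act on \<open>{1..l}\<close> while lists are indexed from 0, so \<open>H\<^sub>i\<close> is
  \<open>H ! (i - 1)\<close>.\<close>

definition hook_perm_content :: "nat list list \<Rightarrow> (nat \<Rightarrow> nat) \<Rightarrow> nat list" where
  "hook_perm_content H \<sigma> = map (\<lambda>i. psize (H ! (\<sigma> i - 1))) [1..<Suc (length H)]"

definition hook_perms :: "nat \<Rightarrow> nat \<Rightarrow> (nat list list \<times> (nat \<Rightarrow> nat)) set" where
  "hook_perms n l =
     {(H, \<sigma>). length H = l \<and> (\<forall>h\<in>set H. is_hook h) \<and> \<sigma> permutes {1..l}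
        \<and> sum_list (map psize H) = n}"

definition signed_set :: "'a set \<Rightarrow> ('a \<Rightarrow> int) \<Rightarrow> bool" where
  "signed_set A sA \<longleftrightarrow> finite A \<and> (\<forall>x\<in>A. sA x \<in> {1, -1})"

definition Fix_on :: "'a set \<Rightarrow> ('a \<Rightarrow> 'a) \<Rightarrow> 'a set" where
  "Fix_on A f = {x \<in> A. f x = x}"

definition sign_reversing_involution :: "'a set \<Rightarrow> ('a \<Rightarrow> int) \<Rightarrow> ('a \<Rightarrow> 'a) \<Rightarrow> bool" where
  "sign_reversing_involution A sA f \<longleftrightarrow>
     (\<forall>x\<in>A. f x \<in> A \<and> f (f x) = x) \<and> (\<forall>x\<in>A - Fix_on A f. sA (f x) = - sA x)"

definition signed_bijection ::
  "'a set \<Rightarrow> ('a \<Rightarrow> int) \<Rightarrow> 'b set \<Rightarrow> ('b \<Rightarrow> int) \<Rightarrow> ('a \<Rightarrow> 'a) \<Rightarrow> ('b \<Rightarrow> 'b) \<Rightarrow> ('a \<Rightarrow> 'b) \<Rightarrow> bool"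
where
  "signed_bijection A sA B sB iA iB \<phi> \<longleftrightarrow>
     signed_set A sA \<and> signed_set B sB
   \<and> sign_reversing_involution A sA iA \<and> sign_reversing_involution B sB iB
   \<and> bij_betw \<phi> (Fix_on A iA) (Fix_on B iB)
   \<and> (\<forall>x\<in>Fix_on A iA. sB (\<phi> x) = sA x)"

end

theory Submission
  imports Defs "HOL-Library.Multiset"
begin

text \<open>It suffices to show that, for each pair of contents \<open>ks\<close>, \<open>ms\<close>, the signed number of pairs
  of ribbon tableaux equals the number of hook permutations: the negative pairs can then be
  cancelled against positive ones within each class of fixed contents. A partition is encoded by
  the set of beads \<open>\<lambda>\<^sub>i - i\<close>; adding a ribbon of size \<open>k\<close> moves one bead by \<open>k\<close> to a free place, and
  its sign counts the beads jumped over. Summing over all such moves gives the current \<open>J\<^sub>k\<close>, a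
  quadratic expression in anticommuting creation and annihilation operators, and the signed number
  of pairs is a vacuum expectation of a product of currents. The Heisenberg relation
  \<open>[J\<^sub>k, J\<^bsub>-m\<^esub>] = k\<close> if \<open>k = m\<close>, and \<open>0\<close> otherwise, evaluates it to a sum over the matchings of equal
  parts of \<open>ks\<close> and \<open>ms\<close>, each of weight \<open>\<Prod>ks\<close>. The matchings are the permutations, and the
  weight is the number of hook sequences of the given sizes, as there are \<open>k\<close> hooks of size \<open>k\<close>.\<close>

section \<open>Currents on bead configurations\<close>

text \<open>Maya diagrams, the basis states of the semi-infinite wedge. The charge is left free
  because a single creation or annihilation changes it.\<close>

definition maya :: "int set \<Rightarrow> bool" where
  "maya X \<longleftrightarrow> (\<exists>L. {..-L} \<subseteq> X \<and> X \<subseteq> {..L})"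

lemma maya_insert [simp]: "maya X \<Longrightarrow> maya (insert a X)"
  unfolding maya_def
proof (elim exE)
  fix L assume "{..-L} \<subseteq> X \<and> X \<subseteq> {..L}"
  then have "{..-max L \<bar>a\<bar>} \<subseteq> insert a X \<and> insert a X \<subseteq> {..max L \<bar>a\<bar>}"
    by (auto simp: subset_iff)
  then show "\<exists>L. {..-L} \<subseteq> insert a X \<and> insert a X \<subseteq> {..L}" by blast
qed

lemma maya_remove [simp]: "maya X \<Longrightarrow> maya (X - {a})"
  unfolding maya_def
proof (elim exE)
  fix L assume "{..-L} \<subseteq> X \<and> X \<subseteq> {..L}"
  then have "{..-max L (\<bar>a\<bar> + 1)} \<subseteq> X - {a} \<and> X - {a} \<subseteq> {..max L (\<bar>a\<bar> + 1)}"
    by (auto simp: subset_iff)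
  then show "\<exists>L. {..-L} \<subseteq> X - {a} \<and> X - {a} \<subseteq> {..L}" by blast
qed

lemma maya_atMost [simp]: "maya {..a}"
  unfolding maya_def by (intro exI[of _ "\<bar>a\<bar>"]) auto

lemma maya_finite_above: "maya X \<Longrightarrow> finite {q \<in> X. a < q}"
  unfolding maya_def
proof (elim exE)
  fix L assume "{..-L} \<subseteq> X \<and> X \<subseteq> {..L}"
  then show ?thesis by (auto intro!: finite_subset[OF _ finite_atLeastAtMost_int[of a L]])
qed

text \<open>The Jordan-Wigner sign at the place \<open>a\<close>. It flips with each bead added
  above \<open>a\<close> only if finitely many beads lie there, since \<open>card\<close> of an
  infinite set is 0; this is the source of the \<open>maya\<close> hypotheses.\<close>

definition sg :: "int \<Rightarrow> int set \<Rightarrow> int" where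
  "sg a X = (-1) ^ card {q \<in> X. a < q}"

lemma sg_insert:
  assumes "maya X" "c \<notin> X"
  shows "sg a (insert c X) = (if a < c then - sg a X else sg a X)"
proof (cases "a < c")
  case True
  then have "{q \<in> insert c X. a < q} = insert c {q \<in> X. a < q}" by auto
  then show ?thesis using True assms maya_finite_above[of X a] by (simp add: sg_def)
next
  case False
  then have "{q \<in> insert c X. a < q} = {q \<in> X. a < q}" by auto
  then show ?thesis using False by (simp add: sg_def)
qed

lemma sg_remove:
  assumes "maya X" "c \<in> X"
  shows "sg a (X - {c}) = (if a < c then - sg a X else sg a X)"
  using sg_insert[of "X - {c}" c a] assms by (simp add: insert_absorb split: if_splits)

lemma sg_sq [simp]: "sg a X * sg a X = 1"
  by (simp add: sg_def power_mult_distrib[symmetric])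

lemma sg_sq2 [simp]: "sg a X * (sg a X * z) = z"
  by (simp add: mult.assoc[symmetric])

section \<open>Creation and annihilation operators and their anticommutation relations\<close>

text \<open>The operators act on functions of configurations: \<open>ann a f\<close> evaluates \<open>f\<close> after
  removing the bead \<open>a\<close>, so the operator applied last moves its bead first.\<close>

definition ann :: "int \<Rightarrow> (int set \<Rightarrow> int) \<Rightarrow> int set \<Rightarrow> int" where
  "ann a f X = (if a \<in> X then sg a X * f (X - {a}) else 0)"

definition cre :: "int \<Rightarrow> (int set \<Rightarrow> int) \<Rightarrow> int set \<Rightarrow> int" where
  "cre a f X = (if a \<notin> X then sg a X * f (insert a X) else 0)"

text \<open>Of two distinct places one lies above the other, so exactly one of the two orders of
  removal picks up an extra sign; for \<open>a = b\<close> both sides vanish. Likewise for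
  \<open>cre_cre\<close>.\<close>

lemma ann_ann: "maya X \<Longrightarrow> ann a (ann b f) X = - ann b (ann a f) X"
  by (cases "a = b") (auto simp: ann_def sg_remove Diff_insert2[symmetric] insert_commute)

lemma cre_cre: "maya X \<Longrightarrow> cre a (cre b f) X = - cre b (cre a f) X"
  by (cases "a = b") (auto simp: cre_def sg_insert insert_commute)

text \<open>For \<open>a = b\<close> exactly one of the two orders is possible, depending on whether
  the place is occupied, and its two signs are equal, so their product is 1. For distinct places the
  argument is that of \<open>ann_ann\<close>.\<close>

lemma cre_ann: "maya X \<Longrightarrow> cre b (ann a f) X = (if a = b then f X else 0) - ann a (cre b f) X"
  by (cases "a = b")
    (auto simp: cre_def ann_def sg_insert sg_remove insert_Diff_if insert_absorb)

lemma ann_cong: "maya X \<Longrightarrow> (\<And>Y. maya Y \<Longrightarrow> f Y = g Y) \<Longrightarrow> ann a f X = ann a g X"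
  by (simp add: ann_def)

section \<open>Hops, currents and the Heisenberg relation\<close>

definition hop :: "int \<Rightarrow> int \<Rightarrow> (int set \<Rightarrow> int) \<Rightarrow> int set \<Rightarrow> int" where
  "hop a b f = ann a (cre b f)"

lemma hop_cong: "maya X \<Longrightarrow> (\<And>Y. maya Y \<Longrightarrow> f Y = g Y) \<Longrightarrow> hop a b f X = hop a b g X"
  by (simp add: hop_def ann_def cre_def)

lemma hop_self: "maya X \<Longrightarrow> hop a a f X = (if a \<in> X then f X else 0)"
  by (auto simp: hop_def ann_def cre_def sg_remove insert_absorb)

lemma hop_eq_0: "a \<notin> X \<or> (b \<in> X \<and> a \<noteq> b) \<Longrightarrow> hop a b f X = 0"
  by (auto simp: hop_def ann_def cre_def)

text \<open>Normal ordering: one use of \<open>cre_ann\<close> brings both annihilations to the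
  front and leaves a contraction when \<open>b = c\<close>.\<close>

lemma hop_hop:
  assumes "maya X"
  shows "hop a b (hop c d f) X = (if b = c then hop a d f X else 0)
    - ann a (ann c (cre b (cre d f))) X"
proof -
  have "hop a b (hop c d f) X
      = ann a (\<lambda>Y. (if c = b then cre d f Y else 0) - ann c (cre b (cre d f)) Y) X"
    unfolding hop_def by (intro ann_cong assms cre_ann)
  then show ?thesis
    by (auto simp: ann_def hop_def algebra_simps)
qed

text \<open>Exchanging the two hops changes the quartic term of \<open>hop_hop\<close> by one sign
  from the annihilations and one from the creations, so it cancels and only the contractions
  survive. These are the commutation relations of matrix units.\<close>

lemma hop_commutator:
  assumes "maya X"
  shows "hop a b (hop c d f) X - hop c d (hop a b f) X
    = (if b = c then hop a d f X else 0) - (if a = d then hop c b f X else 0)"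
proof -
  have "ann a (ann c (cre b (cre d f))) X = - ann c (ann a (cre b (cre d f))) X"
    by (rule ann_ann[OF assms])
  also have "ann c (ann a (cre b (cre d f))) X = ann c (ann a (\<lambda>Y. - cre d (cre b f) Y)) X"
    by (simp add: ann_def assms cre_cre[of _ b d])
  also have "\<dots> = - ann c (ann a (cre d (cre b f))) X"
    by (simp add: ann_def)
  finally show ?thesis using assms by (simp add: hop_hop)
qed

text \<open>Restricting the sum to legal moves makes it finite for a Maya diagram; for
  \<open>c \<noteq> 0\<close> the omitted hops vanish anyway. For \<open>c = 0\<close> the sum is
  empty.\<close>

definition current :: "int \<Rightarrow> (int set \<Rightarrow> int) \<Rightarrow> int set \<Rightarrow> int" where
  "current c f X = (\<Sum>p | p \<in> X \<and> p + c \<notin> X. hop p (p + c) f X)"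

lemma finite_movable: "maya X \<Longrightarrow> finite {p. p \<in> X \<and> p + c \<notin> X}"
  unfolding maya_def
proof (elim exE)
  fix L assume L: "{..-L} \<subseteq> X \<and> X \<subseteq> {..L}"
  have "{p. p \<in> X \<and> p + c \<notin> X} \<subseteq> {-L - c..L}"
  proof
    fix p assume "p \<in> {p. p \<in> X \<and> p + c \<notin> X}"
    with L have "p \<le> L" "\<not> p + c \<le> - L" by auto
    then show "p \<in> {-L - c..L}" by auto
  qed
  then show ?thesis by (rule finite_subset) auto
qed

lemma current_cong: "maya X \<Longrightarrow> (\<And>Y. maya Y \<Longrightarrow> f Y = g Y) \<Longrightarrow> current c f X = current c g X"
  unfolding current_def by (intro sum.cong refl hop_cong) auto

lemma hop_sum: "hop a b (\<lambda>Y. \<Sum>r\<in>I. F r Y) X = (\<Sum>r\<in>I. hop a b (F r) X)"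
  by (simp add: hop_def ann_def cre_def sum_distrib_left)

lemma current_mult: "current c (\<lambda>Y. z * f Y) X = z * current c f X"
  by (auto simp: current_def hop_def ann_def cre_def sum_distrib_left algebra_simps intro!: sum.cong)

text \<open>A window independent of the configuration allows sums over moves to be interchanged,
  which the defining index set does not.\<close>

lemma current_eq_sum:
  assumes "{..-L} \<subseteq> X" "X \<subseteq> {..L}" "c \<noteq> 0" "L + \<bar>c\<bar> \<le> M"
  shows "current c f X = (\<Sum>p=-M..M. hop p (p + c) f X)"
  unfolding current_def
proof (rule sum.mono_neutral_left)
  show "{p. p \<in> X \<and> p + c \<notin> X} \<subseteq> {-M..M}"
  proof
    fix p assume "p \<in> {p. p \<in> X \<and> p + c \<notin> X}"
    with assms have "p \<le> L" "\<not> p + c \<le> - L" by auto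
    with assms show "p \<in> {-M..M}" by auto
  qed
  show "\<forall>p\<in>{- M..M} - {p. p \<in> X \<and> p + c \<notin> X}. hop p (p + c) f X = 0"
    using assms(3) by (auto intro!: hop_eq_0)
qed simp

text \<open>A legal move by \<open>c\<close> only widens the bound \<open>L\<close> to
  \<open>L + \<bar>c\<bar>\<close>, so one window serves for the inner and the outer sum; after an
  illegal first move both sides vanish.\<close>

lemma current_current_eq_sum:
  assumes "{..-L} \<subseteq> X" "X \<subseteq> {..L}" "c \<noteq> 0" "d \<noteq> 0" "L + \<bar>c\<bar> + \<bar>d\<bar> \<le> M"
  shows "current c (current d f) X
    = (\<Sum>p=-M..M. \<Sum>q=-M..M. hop p (p + c) (hop q (q + d) f) X)"
proof -
  have "hop p (p + c) (current d f) X
      = hop p (p + c) (\<lambda>Y. \<Sum>q=-M..M. hop q (q + d) f Y) X" for p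
  proof (cases "p \<in> X \<and> p + c \<notin> X")
    case True
    then have p: "p \<le> L" "\<not> p + c \<le> - L" using assms by auto
    have "current d f (insert (p + c) (X - {p}))
        = (\<Sum>q=-M..M. hop q (q + d) f (insert (p + c) (X - {p})))"
    proof (rule current_eq_sum)
      show "{..-(L + \<bar>c\<bar>)} \<subseteq> insert (p + c) (X - {p})"
        using p assms(1) by (auto simp: subset_iff)
      show "insert (p + c) (X - {p}) \<subseteq> {..L + \<bar>c\<bar>}"
        using p assms(2) by (auto simp: subset_iff)
    qed (use assms in auto)
    then show ?thesis by (simp add: hop_def ann_def cre_def)
  next
    case False
    then have "hop p (p + c) g X = 0" for g using assms(3) by (intro hop_eq_0) auto
    then show ?thesis by simp
  qed
  then show ?thesis
    using assms by (simp add: current_eq_sum[of L X c M] hop_sum)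
qed

lemma current_commutator:
  assumes "maya X" "c \<noteq> 0" "d \<noteq> 0" "d = - c \<Longrightarrow> c > 0"
  shows "current c (current d f) X - current d (current c f) X = (if d = - c then c * f X else 0)"
proof -
  from assms(1) obtain L where L: "{..-L} \<subseteq> X" "X \<subseteq> {..L}" by (auto simp: maya_def)
  \<comment> \<open>The double sum over \<open>p\<close>, \<open>q\<close> telescopes; cut off at \<open>M\<close>, its boundary terms lie in the
    constant part of the configuration, and for \<open>d = - c\<close> the \<open>c\<close> beads at the lower end are left over.\<close>
  define M where "M = \<bar>L\<bar> + 2 * \<bar>c\<bar> + 2 * \<bar>d\<bar>"
  let ?h = "\<lambda>p. hop p (p + c + d) f X"
  have "current c (current d f) X - current d (current c f) X
    = (\<Sum>p=-M..M. \<Sum>q=-M..M. hop p (p + c) (hop q (q + d) f) X)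
      - (\<Sum>q=-M..M. \<Sum>p=-M..M. hop q (q + d) (hop p (p + c) f) X)"
    using L assms by (simp add: current_current_eq_sum[of L X _ _ M] M_def)
  also have "\<dots> = (\<Sum>p=-M..M. \<Sum>q=-M..M. hop p (p + c) (hop q (q + d) f) X
        - hop q (q + d) (hop p (p + c) f) X)"
    by (subst (2) sum.swap) (simp add: sum_subtractf)
  also have "\<dots> = (\<Sum>p=-M..M. \<Sum>q=-M..M. (if p + c = q then ?h p else 0)
        - (if p = q + d then hop q (p + c) f X else 0))" (is "_ = (\<Sum>p\<in>_. \<Sum>q\<in>_. ?t p q - ?u p q)")
    by (intro sum.cong refl) (subst hop_commutator[OF assms(1)], auto simp: algebra_simps)
  also have "\<dots> = (\<Sum>p=-M..M. \<Sum>q=-M..M. ?t p q) - (\<Sum>q=-M..M. \<Sum>p=-M..M. ?u p q)"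
    unfolding sum_subtractf by (rule arg_cong2[OF refl sum.swap, of "(-)"])
  \<comment> \<open>The delta forces \<open>p = q + d\<close>, hence
    \<open>p + c = q + c + d\<close>: both families of contractions have the same summand
    \<open>?h\<close> and differ only in their cutoffs.\<close>
  also have "(\<Sum>q=-M..M. \<Sum>p=-M..M. ?u p q) = (\<Sum>q=-M..M. if q + d \<in> {-M..M} then ?h q else 0)"
    by (intro sum.cong refl) (subst sum.delta, auto simp: algebra_simps)
  also have "(\<Sum>p=-M..M. \<Sum>q=-M..M. ?t p q) = (\<Sum>p=-M..M. if p + c \<in> {-M..M} then ?h p else 0)"
    by (intro sum.cong refl) (subst sum.delta', auto)
  also have "(\<Sum>p=-M..M. if p + c \<in> {-M..M} then ?h p else 0)
      - (\<Sum>q=-M..M. if q + d \<in> {-M..M} then ?h q else 0) = (if d = - c then c * f X else 0)"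
  proof (cases "d = - c")
    case False
    \<comment> \<open>A nonzero \<open>?h p\<close> has \<open>p \<le> L\<close> and
      \<open>p + c + d > -L\<close>; then \<open>p + c\<close> and \<open>p + d\<close> both lie
      well inside the window, so the two cutoffs agree on it.\<close>
    have "?h p = 0" if "\<not> (p + c \<in> {-M..M} \<longleftrightarrow> p + d \<in> {-M..M})" for p
    proof (rule hop_eq_0, rule ccontr)
      assume "\<not> (p \<notin> X \<or> p + c + d \<in> X \<and> p \<noteq> p + c + d)"
      then have "p \<le> L" "\<not> p + c + d \<le> -L" using L False by auto
      with that show False unfolding M_def by auto
    qed
    then show ?thesis using False
      unfolding sum_subtractf[symmetric] by (auto intro!: sum.neutral)
  next
    case True
    with assms(4) have "c > 0" by simp
    have "(\<Sum>p=-M..M. if p + c \<in> {-M..M} then ?h p else 0)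
        - (\<Sum>q=-M..M. if q + d \<in> {-M..M} then ?h q else 0)
      = (\<Sum>p=-M..M. (if p < -M + c then f X else 0))"
      unfolding sum_subtractf[symmetric]
    proof (intro sum.cong refl)
      fix p assume p: "p \<in> {-M..M}"
      have "p \<in> X" if "p < -M + c"
      proof -
        have "p \<in> {..-L}" using that \<open>c > 0\<close> by (auto simp: M_def)
        then show ?thesis using L by blast
      qed
      moreover have "p \<notin> X" if "p + c > M"
      proof
        assume "p \<in> X"
        then have "p \<le> L" using L by auto
        then show False using that \<open>c > 0\<close> by (auto simp: M_def)
      qed
      moreover have "?h p = (if p \<in> X then f X else 0)"
        using True by (simp add: hop_self[OF assms(1)])
      ultimately show "(if p + c \<in> {-M..M} then ?h p else 0)
        - (if p + d \<in> {-M..M} then ?h p else 0) = (if p < -M + c then f X else 0)"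
        using p True \<open>c > 0\<close> by (cases "p \<in> X") (auto simp: M_def)
    qed
    also have "\<dots> = (\<Sum>p=-M..<-M+c. f X)"
      by (intro sum.mono_neutral_cong_right) (use \<open>c > 0\<close> in \<open>auto simp: M_def\<close>)
    also have "\<dots> = c * f X" using \<open>c > 0\<close> by simp
    finally show ?thesis using True by simp
  qed
  finally show ?thesis .
qed

text \<open>\<open>amp ms X\<close> is the signed number of ways to reduce \<open>X\<close> to the vacuum by downward moves
  of lengths \<open>ms\<close>, starting with the head of the list.\<close>

fun amp :: "nat list \<Rightarrow> int set \<Rightarrow> int" where
  "amp [] X = (if X = {..0} then 1 else 0)"
| "amp (m # ms) X = current (- int m) (amp ms) X"

text \<open>\<open>lower ks g\<close> is the signed sum of \<open>g\<close> over the results of moving beads of the vacuum upwards,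
  where the head of \<open>ks\<close> is the length of the last move.\<close>

fun lower :: "nat list \<Rightarrow> (int set \<Rightarrow> int) \<Rightarrow> int" where
  "lower [] g = g {..0}"
| "lower (k # ks) g = lower ks (current (int k) g)"

text \<open>The number of ways to match the entries of \<open>ks\<close> with equal elements of \<open>M\<close>.\<close>

fun pairings :: "nat list \<Rightarrow> nat multiset \<Rightarrow> nat" where
  "pairings [] M = (if M = {#} then 1 else 0)"
| "pairings (k # ks) M = count M k * pairings ks (M - {#k#})"

lemma current_Cons: "current c (amp (m # ms)) X = current c (current (- int m) (amp ms)) X"
  by (rule arg_cong[of _ _ "\<lambda>g. current c g X"]) auto

text \<open>Two downward currents commute, as two negative indices never sum to 0; thus the first
  \<open>k\<close> in the list can be brought to the front.\<close>

lemma amp_Cons_remove1: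
  assumes "maya X" "0 \<notin> set ms" "k \<in> set ms"
  shows "amp (k # remove1 k ms) X = amp ms X"
  using assms
proof (induction ms arbitrary: X)
  case (Cons m ms)
  show ?case
  proof (cases "k = m")
    case False
    have "amp (k # remove1 k (m # ms)) X = current (- int k) (current (- int m) (amp (remove1 k ms))) X"
      using False by (simp add: current_Cons del: amp.simps(2)) (simp add: current_Cons)
    also have "\<dots> = current (- int m) (current (- int k) (amp (remove1 k ms))) X"
      using current_commutator[of X "- int k" "- int m" "amp (remove1 k ms)"] Cons.prems False by auto
    also have "\<dots> = current (- int m) (amp ms) X"
      using Cons False by (intro current_cong) auto
    finally show ?thesis by simp
  qed auto
qed auto

text \<open>The upward current is commuted through the downward ones. Each part equal to
  \<open>k\<close> leaves a factor \<open>k\<close> by the Heisenberg relation, and what remains at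
  the end is 0 because no upward move ends in the vacuum.\<close>

lemma current_amp:
  assumes "maya X" "k > 0" "0 \<notin> set ms"
  shows "current (int k) (amp ms) X = int (k * count (mset ms) k) * amp (remove1 k ms) X"
  using assms
proof (induction ms arbitrary: X)
  case Nil
  have "hop p (p + int k) (amp []) X = 0" for p
  proof -
    \<comment> \<open>The move vacates \<open>p\<close>, which lies below
      \<open>p + int k \<le> 0\<close>, whereas the vacuum has no hole there.\<close>
    have "insert (p + int k) (X - {p}) \<noteq> {..0}"
    proof
      assume *: "insert (p + int k) (X - {p}) = {..0}"
      then have "p + int k \<le> 0" by auto
      with Nil have "p \<in> {..0}" by auto
      with Nil show False unfolding *[symmetric] by auto
    qed
    then show ?thesis by (auto simp: hop_def ann_def cre_def)
  qed
  then show ?case by (simp add: current_def del: amp.simps)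
next
  case (Cons m ms)
  have IH: "current (int k) (amp ms) Y = int (k * count (mset ms) k) * amp (remove1 k ms) Y"
    if "maya Y" for Y using Cons that by auto
  have "current (int k) (amp (m # ms)) X = current (int k) (current (- int m) (amp ms)) X"
    by (rule current_Cons)
  also have "\<dots> = current (- int m) (current (int k) (amp ms)) X + (if k = m then int k * amp ms X else 0)"
    using current_commutator[of X "int k" "- int m" "amp ms"] Cons.prems by auto
  also have "current (- int m) (current (int k) (amp ms)) X
      = int (k * count (mset ms) k) * current (- int m) (amp (remove1 k ms)) X"
    unfolding current_mult[symmetric] by (intro current_cong IH Cons.prems)
  also have "current (- int m) (amp (remove1 k ms)) X = amp (m # remove1 k ms) X" by simp
  finally have *: "current (int k) (amp (m # ms)) X = int (k * count (mset ms) k) * amp (m # remove1 k ms) X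
      + (if k = m then int k * amp ms X else 0)" .
  show ?case
  proof (cases "k = m")
    case True
    \<comment> \<open>If \<open>k\<close> does not occur in \<open>ms\<close>, the two amplitudes
      may differ, but the coefficient is 0.\<close>
    have "int (k * count (mset ms) k) * amp (k # remove1 k ms) X = int (k * count (mset ms) k) * amp ms X"
    proof (cases "k \<in> set ms")
      case True
      then show ?thesis using amp_Cons_remove1[of X ms k] Cons.prems by simp
    qed (simp add: count_mset_0_iff)
    then show ?thesis unfolding * using True by (simp add: algebra_simps del: amp.simps(2))
  next
    case False
    then show ?thesis unfolding * by simp
  qed
qed

lemma lower_cong: "(\<And>Y. maya Y \<Longrightarrow> f Y = g Y) \<Longrightarrow> lower ks f = lower ks g"
proof (induction ks arbitrary: f g)
  case (Cons k ks)
  have "lower ks (current (int k) f) = lower ks (current (int k) g)"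
    by (rule Cons.IH) (rule current_cong[OF _ Cons.prems])
  then show ?case by simp
qed simp

lemma lower_mult: "lower ks (\<lambda>Y. z * f Y) = z * lower ks f"
proof (induction ks arbitrary: f)
  case (Cons k ks)
  have "current (int k) (\<lambda>Y. z * f Y) = (\<lambda>Y. z * current (int k) f Y)"
    by (rule ext) (rule current_mult)
  then show ?case using Cons by simp
qed simp

text \<open>Each upward move is contracted with one of the equal downward moves by
  \<open>current_amp\<close>: the factors \<open>k\<close> collect to the product and the counts to
  \<open>pairings\<close>.\<close>

lemma lower_amp:
  assumes "0 \<notin> set ks" "0 \<notin> set ms"
  shows "lower ks (amp ms) = int (prod_list ks * pairings ks (mset ms))"
  using assms
proof (induction ks arbitrary: ms)
  case Nil
  then show ?case
  proof (cases ms)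
    case (Cons m ns)
    \<comment> \<open>Every place below a bead of the vacuum is occupied, so no downward move
      exists.\<close>
    then have "{p. p \<in> {..0} \<and> p + - int m \<notin> {..0}} = {}" by auto
    then have "current (- int m) (amp ns) {..0} = 0" unfolding current_def by (metis sum.empty)
    then show ?thesis using Cons by simp
  qed simp
next
  case (Cons k ks)
  have "lower (k # ks) (amp ms) = lower ks (\<lambda>X. int (k * count (mset ms) k) * amp (remove1 k ms) X)"
    using Cons.prems by (auto intro!: lower_cong simp: current_amp)
  also have "\<dots> = int (k * count (mset ms) k) * lower ks (amp (remove1 k ms))"
    by (rule lower_mult)
  also have "lower ks (amp (remove1 k ms)) = int (prod_list ks * pairings ks (mset ms - {#k#}))"
    using Cons notin_set_remove1[of 0 ms k] by simp
  finally show ?case by simp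
qed

section \<open>Beads of a partition and ribbons\<close>

text \<open>Padding with zero rows gives every partition infinitely many beads, so partitions of
  different lengths can be compared; the empty partition becomes the vacuum
  \<open>{..0}\<close>.\<close>

definition row :: "nat list \<Rightarrow> nat \<Rightarrow> nat" where
  "row lam i = (if i < length lam then lam ! i else 0)"

definition bead :: "nat list \<Rightarrow> nat \<Rightarrow> int" where
  "bead lam i = int (row lam i) - int i"

definition beads :: "nat list \<Rightarrow> int set" where
  "beads lam = range (bead lam)"

lemma diagram_row: "diagram lam = {(i, j). j < row lam i}"
  by (auto simp: diagram_def row_def split: if_splits)

lemma mem_skew_iff: "(i, j) \<in> skew mu lam \<longleftrightarrow> row lam i \<le> j \<and> j < row mu i"
  by (auto simp: skew_def diagram_row)

lemma diagram_subset_iff: "diagram lam \<subseteq> diagram mu \<longleftrightarrow> (\<forall>i. row lam i \<le> row mu i)"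
proof
  assume sub: "diagram lam \<subseteq> diagram mu"
  show "\<forall>i. row lam i \<le> row mu i"
  proof (rule allI, rule ccontr)
    fix i assume "\<not> row lam i \<le> row mu i"
    then have "(i, row mu i) \<in> diagram lam - diagram mu" by (simp add: diagram_row)
    with sub show False by blast
  qed
next
  assume "\<forall>i. row lam i \<le> row mu i"
  then show "diagram lam \<subseteq> diagram mu"
    by (auto simp: diagram_row intro: less_le_trans)
qed

lemma row_antimono: "is_partition lam \<Longrightarrow> i \<le> j \<Longrightarrow> row lam j \<le> row lam i"
  by (cases "i = j") (auto simp: is_partition_def row_def sorted_wrt_iff_nth_less)

lemma row_pos_iff: "is_partition lam \<Longrightarrow> row lam i > 0 \<longleftrightarrow> i < length lam"
  by (auto simp: is_partition_def row_def)

lemma bead_less: "is_partition lam \<Longrightarrow> i < j \<Longrightarrow> bead lam j < bead lam i"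
  using row_antimono[of lam i j] by (simp add: bead_def)

lemma bead_less_iff: "is_partition lam \<Longrightarrow> bead lam j < bead lam i \<longleftrightarrow> i < j"
  using bead_less[of lam i j] bead_less[of lam j i] by (cases i j rule: linorder_cases) auto

lemma bead_eq_iff: "is_partition lam \<Longrightarrow> bead lam j = bead lam i \<longleftrightarrow> i = j"
  by (metis bead_less linorder_neqE_nat order_less_irrefl)

lemma partition_eqI:
  assumes "is_partition lam" "is_partition mu" "\<And>i. row lam i = row mu i"
  shows "lam = mu"
proof (rule nth_equalityI)
  have *: "i < length lam \<longleftrightarrow> i < length mu" for i
    using row_pos_iff[OF assms(1)] row_pos_iff[OF assms(2)] assms(3) by metis
  show "length lam = length mu"
    using *[of "length lam"] *[of "length mu"] by simp
  fix i assume "i < length lam"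
  then show "lam ! i = mu ! i" using assms(3)[of i] * by (simp add: row_def)
qed

text \<open>The beads decrease strictly in the row index, so the set determines the sequence. By
  induction the larger beads agree, hence so do the largest remaining ones.\<close>

lemma beads_inject:
  assumes "is_partition lam" "is_partition mu" "beads lam = beads mu"
  shows "lam = mu"
proof -
  have "bead lam i = bead mu i" for i
  proof (induction i rule: less_induct)
    case (less i)
    obtain j where j: "bead lam i = bead mu j" using assms(3) by (metis beads_def rangeE rangeI)
    obtain j' where j': "bead mu i = bead lam j'" using assms(3) by (metis beads_def rangeE rangeI)
    have "\<not> j < i" using less[of j] j bead_eq_iff[OF assms(1)] by (metis order_less_irrefl)
    moreover have "\<not> j' < i" using less[of j'] j' bead_eq_iff[OF assms(2)] by (metis order_less_irrefl)
    ultimately show ?case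
      using j j' bead_less[OF assms(1), of i j'] bead_less[OF assms(2), of i j]
      by (metis linorder_neqE_nat order_less_asym')
  qed
  then show ?thesis using assms by (intro partition_eqI) (simp_all add: bead_def)
qed

lemma beads_Nil: "beads [] = {..0}"
proof (intro set_eqI iffI)
  fix x :: int assume "x \<in> {..0}"
  then have "x = bead [] (nat (- x))" by (simp add: bead_def row_def)
  then show "x \<in> beads []" by (auto simp: beads_def)
qed (auto simp: beads_def bead_def row_def)

lemma maya_beads:
  assumes "is_partition lam"
  shows "maya (beads lam)"
  unfolding maya_def
proof (intro exI conjI)
  let ?L = "int (row lam 0) + int (length lam)"
  show "{..-?L} \<subseteq> beads lam"
  proof
    fix x assume "x \<in> {..-?L}"
    then have "x = bead lam (nat (- x))" by (auto simp: bead_def row_def)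
    then show "x \<in> beads lam" by (auto simp: beads_def)
  qed
  have "bead lam i \<le> ?L" for i
    using row_antimono[OF assms, of 0 i] by (simp add: bead_def)
  then show "beads lam \<subseteq> {..?L}" by (auto simp: beads_def)
qed

lemma partition_of_rows:
  assumes anti: "\<And>i. r (Suc i) \<le> r i" and zero: "r n = 0"
  shows "\<exists>mu. is_partition mu \<and> (\<forall>i. row mu i = r i)"
proof -
  define m where "m = (LEAST i. r i = 0)"
  have mono: "r j \<le> r i" if "i \<le> j" for i j
    using lift_Suc_antimono_le[of r i j] anti that by blast
  have m: "r m = 0" unfolding m_def by (rule LeastI[of _ n]) (rule zero)
  have "r i > 0" if "i < m" for i using not_less_Least[of i "\<lambda>i. r i = 0"] that by (auto simp: m_def)
  moreover have "r i = 0" if "m \<le> i" for i using mono[OF that] m by simp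
  ultimately have "is_partition (map r [0..<m]) \<and> (\<forall>i. row (map r [0..<m]) i = r i)"
    by (auto simp: is_partition_def row_def sorted_wrt_iff_nth_less mono)
  then show ?thesis by blast
qed

section \<open>Ribbons as moves of a single bead\<close>

text \<open>The skew shape is a ribbon with rows \<open>r\<close> to \<open>s\<close>: connectedness and the absence of a
  square mean that consecutive rows overlap in exactly one column.\<close>

definition ribbon_rows :: "nat list \<Rightarrow> nat list \<Rightarrow> nat \<Rightarrow> nat \<Rightarrow> bool" where
  "ribbon_rows lam mu r s \<longleftrightarrow> r \<le> s \<and> (\<forall>i. i < r \<or> s < i \<longrightarrow> row mu i = row lam i)
    \<and> (\<forall>i. r \<le> i \<and> i < s \<longrightarrow> row mu (Suc i) = Suc (row lam i)) \<and> row lam s < row mu s"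

lemma ribbon_rows_less:
  assumes "is_partition mu" "ribbon_rows lam mu r s" "r \<le> i" "i \<le> s"
  shows "row lam i < row mu i"
proof (cases "i = s")
  case False
  then have "row mu (Suc i) = Suc (row lam i)" using assms by (auto simp: ribbon_rows_def)
  then show ?thesis using row_antimono[OF assms(1), of i "Suc i"] by simp
qed (use assms in \<open>auto simp: ribbon_rows_def\<close>)

lemma ribbon_rows_skew:
  assumes "is_partition mu" "ribbon_rows lam mu r s"
  shows "skew mu lam = (SIGMA i:{r..s}. {row lam i..<row mu i})"
  using assms(2) by (auto simp: mem_skew_iff ribbon_rows_def) (metis not_le not_less)+

lemma ribbon_rows_fst:
  assumes "is_partition mu" "ribbon_rows lam mu r s"
  shows "fst ` skew mu lam = {r..s}"
  unfolding ribbon_rows_skew[OF assms] fst_image_Sigma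
  using ribbon_rows_less[OF assms] by auto

text \<open>Inside the ribbon \<open>bead mu (Suc i) = bead lam i\<close>, so the row lengths
  \<open>bead mu i - bead lam i\<close> telescope.\<close>

lemma ribbon_rows_card:
  assumes "is_partition mu" "ribbon_rows lam mu r s"
  shows "int (card (skew mu lam)) = bead mu r - bead lam s"
proof -
  have rs: "r \<le> s" using assms by (simp add: ribbon_rows_def)
  have "int (card (skew mu lam)) = (\<Sum>i=r..s. int (row mu i - row lam i))"
    unfolding ribbon_rows_skew[OF assms] by (simp add: card_SigmaI)
  also have "\<dots> = (\<Sum>i=r..s. bead mu i - bead lam i)"
    by (intro sum.cong refl) (use ribbon_rows_less[OF assms] in \<open>force simp: bead_def\<close>)
  also have "\<dots> = (\<Sum>i=r..s. bead mu i) - (\<Sum>i=r..s. bead lam i)" by (simp add: sum_subtractf)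
  also have "(\<Sum>i=r..s. bead mu i) = bead mu r + (\<Sum>i=r..<s. bead mu (Suc i))"
    using rs by (induction s rule: dec_induct) simp_all
  also have "(\<Sum>i=r..<s. bead mu (Suc i)) = (\<Sum>i=r..<s. bead lam i)"
    using assms(2) by (intro sum.cong) (auto simp: bead_def ribbon_rows_def)
  also have "(\<Sum>i=r..s. bead lam i) = (\<Sum>i=r..<s. bead lam i) + bead lam s"
    using rs by (simp add: sum.last_plus add.commute)
  finally show ?thesis by simp
qed

text \<open>Rows above \<open>r\<close> carry the same beads in both partitions, distinct from that
  of row \<open>r\<close> of \<open>mu\<close>; from row \<open>r\<close> on, the beads of
  \<open>lam\<close> are smaller than \<open>bead mu r\<close>.\<close>

lemma ribbon_rows_notin:
  assumes "is_partition lam" "is_partition mu" "ribbon_rows lam mu r s"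
  shows "bead mu r \<notin> beads lam"
proof
  assume "bead mu r \<in> beads lam"
  then obtain i where i: "bead mu r = bead lam i" by (auto simp: beads_def)
  show False
  proof (cases "i < r")
    case True
    then have "bead lam i = bead mu i" using assms by (simp add: ribbon_rows_def bead_def)
    then show False using i True bead_eq_iff[OF assms(2)] by simp
  next
    case False
    then have "bead lam i \<le> bead lam r" using bead_less[OF assms(1), of r i] by (cases "i = r") auto
    also have "\<dots> < bead mu r"
      using ribbon_rows_less[OF assms(2,3), of r] assms(3) by (simp add: bead_def ribbon_rows_def)
    finally show False using i by simp
  qed
qed

text \<open>Beads strictly inside the ribbon are only renumbered by one row, which the set does not
  see.\<close>

lemma ribbon_rows_beads:
  assumes "is_partition lam" "is_partition mu" "ribbon_rows lam mu r s"
  shows "beads mu = insert (bead mu r) (beads lam - {bead lam s})"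
proof (intro equalityI subsetI)
  have shift: "bead mu (Suc i) = bead lam i" if "r \<le> i" "i < s" for i
    using that assms(3) by (simp add: ribbon_rows_def bead_def)
  have same: "bead mu i = bead lam i" if "i < r \<or> s < i" for i
    using that assms(3) by (auto simp: ribbon_rows_def bead_def)
  fix x
  {
    assume "x \<in> beads mu"
    then obtain i where i: "x = bead mu i" by (auto simp: beads_def)
    have "x = bead mu r \<or> (\<exists>j. j \<noteq> s \<and> x = bead lam j)"
    proof (cases "r < i \<and> i \<le> s")
      case True
      then obtain j where "i = Suc j" by (cases i) auto
      then have "x = bead lam j" "j \<noteq> s" using True i shift[of j] by auto
      then show ?thesis by blast
    next
      case False
      moreover have "r \<le> s" using assms(3) by (simp add: ribbon_rows_def)
      ultimately consider "i = r" | "i < r \<or> s < i" "i \<noteq> s" by linarith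
      then show ?thesis using i same[of i] by cases blast+
    qed
    then show "x \<in> insert (bead mu r) (beads lam - {bead lam s})"
      by (auto simp: beads_def bead_eq_iff[OF assms(1)])
  }
  {
    assume "x \<in> insert (bead mu r) (beads lam - {bead lam s})"
    then consider "x = bead mu r" | i where "x = bead lam i" "i \<noteq> s" by (auto simp: beads_def)
    then show "x \<in> beads mu"
    proof cases
      case 2
      then show ?thesis using shift[of i] same[of i] unfolding beads_def
        by (metis linorder_neqE_nat not_le rangeI)
    qed (auto simp: beads_def)
  }
qed

text \<open>There are \<open>s\<close> beads above the origin of the move and \<open>r\<close> above
  its target; the parity of \<open>s + r\<close> is that of the height \<open>s - r\<close>.\<close>

lemma ribbon_rows_sign:
  assumes "is_partition lam" "is_partition mu" "ribbon_rows lam mu r s"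
  shows "sg (bead lam s) (beads lam) * sg (bead mu r) (beads lam - {bead lam s})
    = ribbon_sign (skew mu lam)"
proof -
  have rs: "r \<le> s" using assms by (simp add: ribbon_rows_def)
  have inj: "inj_on (bead lam) A" for A using bead_eq_iff[OF assms(1)] by (auto intro: inj_onI)
  have "{q \<in> beads lam. bead lam s < q} = bead lam ` {..<s}"
    by (auto simp: beads_def bead_less_iff[OF assms(1)])
  then have 1: "card {q \<in> beads lam. bead lam s < q} = s" using inj by (simp add: card_image)
  have gt: "bead mu r < bead lam i \<longleftrightarrow> i < r" for i
  proof
    assume "i < r"
    then have "bead lam i = bead mu i" using assms by (simp add: ribbon_rows_def bead_def)
    then show "bead mu r < bead lam i" using bead_less[OF assms(2) \<open>i < r\<close>] by simp
  next
    assume *: "bead mu r < bead lam i"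
    have "bead lam r < bead mu r"
      using ribbon_rows_less[OF assms(2,3), of r] rs by (simp add: bead_def)
    with * have "bead lam r < bead lam i" by simp
    then show "i < r" by (simp add: bead_less_iff[OF assms(1)])
  qed
  have "{q \<in> beads lam - {bead lam s}. bead mu r < q} = bead lam ` {..<r}"
    using rs by (auto simp: beads_def gt bead_eq_iff[OF assms(1)])
  then have 2: "card {q \<in> beads lam - {bead lam s}. bead mu r < q} = r" using inj by (simp add: card_image)
  have "ribbon_height (skew mu lam) = s - r"
    using rs by (simp add: ribbon_height_def ribbon_rows_fst[OF assms(2,3)])
  then show ?thesis
    unfolding sg_def 1 2 ribbon_sign_def using rs by (auto simp: minus_one_power_iff)
qed

text \<open>Every cell is joined to the first cell of row \<open>s\<close>: go left to the start of
  the row and step down, which lands on the last cell of the next row.\<close>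

lemma ribbon_rows_connected:
  assumes lam: "is_partition lam" and mu: "is_partition mu" and rr: "ribbon_rows lam mu r s"
  shows "connected_cells (skew mu lam)"
proof -
  let ?S = "skew mu lam"
  define R where "R = {(a, b). a \<in> ?S \<and> b \<in> ?S \<and> share_side a b}"
  have sym: "sym (R\<^sup>*)" unfolding R_def by (intro sym_rtrancl) (auto simp: sym_def share_side_def)
  have left: "((i, row lam i + d), (i, row lam i)) \<in> R\<^sup>*" if "row lam i + d < row mu i" for i d
    using that
  proof (induction d)
    case (Suc d)
    then have "((i, row lam i + Suc d), (i, row lam i + d)) \<in> R"
      by (auto simp: R_def mem_skew_iff share_side_def)
    moreover have "((i, row lam i + d), (i, row lam i)) \<in> R\<^sup>*" using Suc by simp
    ultimately show ?case by (rule converse_rtrancl_into_rtrancl)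
  qed simp
  have down: "((i, row lam i), (s, row lam s)) \<in> R\<^sup>*" if "i \<le> s" "r \<le> i" for i
    using that
  proof (induction i rule: inc_induct)
    case (step i)
    have a: "row mu (Suc i) = Suc (row lam i)" using rr step by (simp add: ribbon_rows_def)
    have b: "row lam (Suc i) \<le> row lam i" by (rule row_antimono[OF lam]) simp
    have c: "Suc (row lam i) \<le> row mu i" using row_antimono[OF mu, of i "Suc i"] a by simp
    have "((i, row lam i), (Suc i, row lam i)) \<in> R"
      using a b c by (auto simp: R_def mem_skew_iff share_side_def)
    moreover have "((Suc i, row lam i), (Suc i, row lam (Suc i))) \<in> R\<^sup>*"
      using left[of "Suc i" "row lam i - row lam (Suc i)"] a b by simp
    moreover have "((Suc i, row lam (Suc i)), (s, row lam s)) \<in> R\<^sup>*" using step by simp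
    ultimately show ?case by (meson converse_rtrancl_into_rtrancl rtrancl_trans)
  qed simp
  have *: "(c, (s, row lam s)) \<in> R\<^sup>*" if "c \<in> ?S" for c
  proof -
    obtain i j where c: "c = (i, j)" by (cases c)
    with that have ij: "r \<le> i" "i \<le> s" "row lam i \<le> j" "j < row mu i"
      unfolding ribbon_rows_skew[OF mu rr] by auto
    then have "(c, (i, row lam i)) \<in> R\<^sup>*" using left[of i "j - row lam i"] c by simp
    with down[OF ij(2,1)] show ?thesis by (meson rtrancl_trans)
  qed
  show ?thesis unfolding connected_cells_def R_def[symmetric]
    using * sym by (meson rtrancl_trans symD)
qed

lemma ribbon_rows_imp_ribbon:
  assumes "is_partition lam" "is_partition mu" "ribbon_rows lam mu r s"
  shows "diagram lam \<subset> diagram mu" "ribbon (skew mu lam)"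
proof -
  have le: "row lam i \<le> row mu i" for i
  proof (cases "r \<le> i \<and> i \<le> s")
    case True
    then show ?thesis using ribbon_rows_less[OF assms(2,3), of i] by simp
  next
    case False
    then show ?thesis using assms(3) by (auto simp: ribbon_rows_def)
  qed
  then have sub: "diagram lam \<subseteq> diagram mu" by (simp add: diagram_subset_iff)
  moreover have "(s, row lam s) \<in> diagram mu - diagram lam"
    using assms(3) by (simp add: ribbon_rows_def diagram_row)
  ultimately show "diagram lam \<subset> diagram mu" by blast
  have "\<not> has_square (skew mu lam)"
  proof
    assume "has_square (skew mu lam)"
    then obtain i j where ij: "(i, j) \<in> skew mu lam" "(Suc i, Suc j) \<in> skew mu lam"
      unfolding has_square_def by blast
    then have "i \<in> {r..s}" "Suc i \<in> {r..s}" unfolding ribbon_rows_skew[OF assms(2,3)] by auto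
    \<comment> \<open>The overlap is a single column, so two diagonal corners of a square already
      contradict it.\<close>
    then have "row mu (Suc i) = Suc (row lam i)" using assms(3) by (simp add: ribbon_rows_def)
    then show False using ij by (simp add: mem_skew_iff)
  qed
  then show "ribbon (skew mu lam)"
    using sub assms ribbon_rows_connected[OF assms] by (auto simp: ribbon_def skew_shape_def)
qed

text \<open>Sharing a side changes the row by at most one, so the path contains a vertical step from
  row \<open>i\<close> to row \<open>Suc i\<close>.\<close>

lemma connected_crossing:
  assumes "(a, b) \<in> {(a, b). a \<in> S \<and> b \<in> S \<and> share_side a b}\<^sup>*" "fst a \<le> i" "i < fst b"
  shows "\<exists>c. (i, c) \<in> S \<and> (Suc i, c) \<in> S"
  using assms(1,3)
proof (induction rule: rtrancl_induct)
  case base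
  then show ?case using assms(2) by simp
next
  case (step b b')
  show ?case
  proof (cases "i < fst b")
    case False
    with step have "b \<in> S" "b' \<in> S" "fst b = i" "fst b' = Suc i" "snd b = snd b'"
      by (auto simp: share_side_def)
    then show ?thesis by (metis prod.collapse)
  qed (use step in auto)
qed

text \<open>Take the first and last row where the partitions differ. Connectedness makes consecutive
  rows between them overlap, and two common columns would give a square.\<close>

lemma ribbon_imp_ribbon_rows:
  assumes lam: "is_partition lam" and mu: "is_partition mu"
    and sub: "diagram lam \<subset> diagram mu" and rib: "ribbon (skew mu lam)"
  shows "\<exists>r s. ribbon_rows lam mu r s"
proof -
  define R where "R = {i. row lam i < row mu i}"
  have "R \<subseteq> {..<length mu}" by (auto simp: R_def row_def split: if_splits)
  then have fin: "finite R" by (rule finite_subset) simp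
  have le: "row lam i \<le> row mu i" for i using sub diagram_subset_iff by blast
  have "R \<noteq> {}"
  proof
    assume "R = {}"
    then have "row mu i \<le> row lam i" for i by (auto simp: R_def not_less)
    then have "diagram mu \<subseteq> diagram lam" by (simp add: diagram_subset_iff)
    with sub show False by blast
  qed
  define r s where "r = Min R" and "s = Max R"
  have r: "r \<in> R" and s: "s \<in> R" using fin \<open>R \<noteq> {}\<close> by (auto simp: r_def s_def)
  have mid: "row mu (Suc i) = Suc (row lam i)" if "r \<le> i" "i < s" for i
  proof -
    have "(r, row lam r) \<in> skew mu lam" "(s, row lam s) \<in> skew mu lam"
      using r s by (auto simp: R_def mem_skew_iff)
    then have "((r, row lam r), (s, row lam s))
        \<in> {(a, b). a \<in> skew mu lam \<and> b \<in> skew mu lam \<and> share_side a b}\<^sup>*"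
      using rib by (auto simp: ribbon_def connected_cells_def)
    from connected_crossing[OF this, of i] that
    obtain c where c: "(i, c) \<in> skew mu lam" "(Suc i, c) \<in> skew mu lam" by auto
    then have "row lam i < row mu (Suc i)" by (auto simp: mem_skew_iff)
    moreover have "\<not> Suc (row lam i) < row mu (Suc i)"
    proof
      assume *: "Suc (row lam i) < row mu (Suc i)"
      have "row mu (Suc i) \<le> row mu i" "row lam (Suc i) \<le> row lam i"
        by (intro row_antimono lam mu, simp)+
      with * have "has_square (skew mu lam)"
        unfolding has_square_def
        by (intro exI[of _ i] exI[of _ "row lam i"]) (auto simp: mem_skew_iff)
      then show False using rib by (simp add: ribbon_def)
    qed
    ultimately show ?thesis by simp
  qed
  have "row mu i = row lam i" if "i < r \<or> s < i" for i
  proof -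
    have "i \<notin> R" using that Min_le[OF fin, of i] Max_ge[OF fin, of i] by (auto simp: r_def s_def)
    then show ?thesis using le[of i] by (simp add: R_def)
  qed
  moreover have "r \<le> s" using fin s by (simp add: r_def)
  ultimately show ?thesis using mid s unfolding ribbon_rows_def R_def by blast
qed

text \<open>Moving a bead upwards and sorting again yields the rows of a partition, which differs
  from \<open>lam\<close> by a ribbon.\<close>

lemma add_ribbon_exists:
  assumes lam: "is_partition lam" and p: "p \<in> beads lam" "p + int k \<notin> beads lam" and "k > 0"
  shows "\<exists>mu r s. is_partition mu \<and> ribbon_rows lam mu r s \<and> p = bead lam s \<and> p + int k = bead mu r"
proof -
  from p obtain s where s: "p = bead lam s" by (auto simp: beads_def)
  \<comment> \<open>The row in which the moved bead is inserted in the decreasing order.\<close>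
  define r where "r = (LEAST i. bead lam i < p + int k)"
  have "bead lam s < p + int k" using s \<open>k > 0\<close> by simp
  then have rs: "r \<le> s" and r: "bead lam r < p + int k"
    unfolding r_def by (auto intro: Least_le LeastI)
  have before: "bead lam i > p + int k" if "i < r" for i
    using not_less_Least[of i "\<lambda>i. bead lam i < p + int k"] that p(2)
    by (auto simp: r_def beads_def) (metis linorder_neqE_linordered_idom rangeI)
  \<comment> \<open>Beads \<open>r\<close> to \<open>s - 1\<close> are pushed down by one row;
    keeping the value of a bead in the next row requires one more cell. Row \<open>r\<close>
    receives the bead \<open>p + int k\<close>.\<close>
  define M where "M = (\<lambda>i. if i < r \<or> s < i then row lam i
    else if i = r then nat (p + int k + int r) else Suc (row lam (i - 1)))"
  have Mr: "int (M r) = p + int k + int r" "row lam r < M r"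
    using rs r by (auto simp: M_def bead_def)
  have "M (Suc i) \<le> M i" for i
  proof -
    have anti: "row lam (Suc i) \<le> row lam i" "row lam (Suc i) \<le> row lam (i - 1)" "row lam i \<le> row lam (i - 1)"
      by (intro row_antimono lam, simp)+
    consider "Suc i < r" | "Suc i = r" | "i = r" | "r < i" "i \<le> s" | "s < i" by linarith
    then show ?thesis
    proof cases
      case 2
      then have "row lam i \<ge> M r" using before[of i] Mr by (auto simp: bead_def)
      then show ?thesis using 2 by (simp add: M_def)
    next
      case 3
      then have "M (Suc i) \<le> Suc (row lam i)" using anti by (auto simp: M_def)
      then show ?thesis using 3 Mr by simp
    qed (use anti rs in \<open>auto simp: M_def\<close>)
  qed
  moreover have "M (Suc s + length lam) = 0" by (simp add: M_def row_def)
  ultimately obtain mu where mu: "is_partition mu" "\<And>i. row mu i = M i"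
    using partition_of_rows[of M] by blast
  have "row lam s < M s"
  proof (cases "r = s")
    case False
    then have "M s = Suc (row lam (s - 1))" using rs by (simp add: M_def)
    then show ?thesis using row_antimono[OF lam, of "s - 1" s] by simp
  qed (use Mr in simp)
  then have "ribbon_rows lam mu r s" using rs mu(2) by (auto simp: ribbon_rows_def M_def)
  moreover have "p + int k = bead mu r" using mu(2) Mr by (simp add: bead_def)
  ultimately show ?thesis using mu s by blast
qed

definition ribbon_extensions :: "nat list \<Rightarrow> nat \<Rightarrow> nat list set" where
  "ribbon_extensions lam k = {mu. is_partition mu \<and> diagram lam \<subset> diagram mu
     \<and> ribbon (skew mu lam) \<and> card (skew mu lam) = k}"

lemma ribbon_extension_bead:
  assumes "is_partition lam" "mu \<in> ribbon_extensions lam k"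
  shows "\<exists>p\<in>beads lam. p + int k \<notin> beads lam \<and> beads mu = insert (p + int k) (beads lam - {p})
    \<and> ribbon_sign (skew mu lam) = sg p (beads lam) * sg (p + int k) (beads lam - {p})"
proof -
  have mu: "is_partition mu" and card: "card (skew mu lam) = k"
    using assms by (auto simp: ribbon_extensions_def)
  obtain r s where rr: "ribbon_rows lam mu r s"
    using ribbon_imp_ribbon_rows[OF assms(1) mu] assms(2) unfolding ribbon_extensions_def by blast
  have k: "bead mu r = bead lam s + int k"
    using ribbon_rows_card[OF mu rr] card by simp
  show ?thesis
    using ribbon_rows_notin[OF assms(1) mu rr] ribbon_rows_beads[OF assms(1) mu rr]
      ribbon_rows_sign[OF assms(1) mu rr] unfolding k
    by (intro bexI[of _ "bead lam s"]) (auto simp: beads_def)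
qed

lemma bead_ribbon_extension:
  assumes "is_partition lam" "k > 0" "p \<in> beads lam" "p + int k \<notin> beads lam"
  shows "\<exists>mu\<in>ribbon_extensions lam k. beads mu = insert (p + int k) (beads lam - {p})"
proof -
  obtain mu r s where mu: "is_partition mu" and rr: "ribbon_rows lam mu r s"
    and p: "p = bead lam s" "p + int k = bead mu r"
    using add_ribbon_exists[OF assms(1,3,4,2)] by blast
  have "card (skew mu lam) = k" using ribbon_rows_card[OF mu rr] p by simp
  then show ?thesis
    using ribbon_rows_imp_ribbon[OF assms(1) mu rr] ribbon_rows_beads[OF assms(1) mu rr] mu p
    by (intro bexI[of _ mu]) (auto simp: ribbon_extensions_def)
qed

text \<open>Legal moves of a bead by \<open>k\<close> correspond bijectively to ribbons of size
  \<open>k\<close>, with equal signs; this identifies adding a ribbon with the current.\<close>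

lemma sum_ribbon_extensions:
  assumes lam: "is_partition lam" and "k > 0"
  shows "finite (ribbon_extensions lam k)"
    and "(\<Sum>mu\<in>ribbon_extensions lam k. ribbon_sign (skew mu lam) * g (beads mu))
      = current (int k) g (beads lam)"
proof -
  let ?X = "beads lam"
  let ?A = "{p. p \<in> ?X \<and> p + int k \<notin> ?X}"
  obtain h where h: "\<And>p. p \<in> ?A \<Longrightarrow> h p \<in> ribbon_extensions lam k"
      "\<And>p. p \<in> ?A \<Longrightarrow> beads (h p) = insert (p + int k) (?X - {p})"
    using bead_ribbon_extension[OF assms] by (metis (mono_tags, lifting) mem_Collect_eq)
  have step_inj: "p = q" if "p \<in> ?A" "q \<in> ?A"
    "insert (p + int k) (?X - {p}) = insert (q + int k) (?X - {q})" for p q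
  proof (rule ccontr)
    \<comment> \<open>The place \<open>p\<close> is free after moving \<open>p\<close>, but still
      occupied after moving another bead.\<close>
    assume "p \<noteq> q"
    then have "p \<in> insert (q + int k) (?X - {q})" using that(1) by simp
    then show False using that(3)[symmetric] \<open>k > 0\<close> by simp
  qed
  have h_eq: "\<exists>p\<in>?A. mu = h p \<and> ribbon_sign (skew mu lam) = sg p ?X * sg (p + int k) (?X - {p})"
    if mu: "mu \<in> ribbon_extensions lam k" for mu
  proof -
    obtain p where p: "p \<in> ?A" "beads mu = insert (p + int k) (?X - {p})"
        "ribbon_sign (skew mu lam) = sg p ?X * sg (p + int k) (?X - {p})"
      using ribbon_extension_bead[OF lam mu] by blast
    then have "mu = h p"
      using mu h[of p] by (intro beads_inject) (auto simp: ribbon_extensions_def)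
    with p show ?thesis by blast
  qed
  have inj: "inj_on h ?A"
  proof (rule inj_onI)
    fix p q assume pq: "p \<in> ?A" "q \<in> ?A" "h p = h q"
    then have "insert (p + int k) (?X - {p}) = insert (q + int k) (?X - {q})"
      using h(2)[OF pq(1)] h(2)[OF pq(2)] by (simp only:)
    then show "p = q" by (rule step_inj[OF pq(1,2)])
  qed
  have bij: "bij_betw h ?A (ribbon_extensions lam k)"
    unfolding bij_betw_def
  proof
    show "inj_on h ?A" by (rule inj)
    show "h ` ?A = ribbon_extensions lam k"
    proof
      show "h ` ?A \<subseteq> ribbon_extensions lam k" using h(1) by (rule image_subsetI)
      show "ribbon_extensions lam k \<subseteq> h ` ?A" using h_eq by blast
    qed
  qed
  show "finite (ribbon_extensions lam k)"
    using bij_betw_finite[OF bij] finite_movable[OF maya_beads[OF lam]] by blast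
  have "ribbon_sign (skew (h p) lam) = sg p ?X * sg (p + int k) (?X - {p})" if p: "p \<in> ?A" for p
  proof -
    obtain q where q: "q \<in> ?A" "h p = h q" "ribbon_sign (skew (h p) lam) = sg q ?X * sg (q + int k) (?X - {q})"
      using h_eq[OF h(1)[OF p]] by blast
    have "p = q" using inj_onD[OF inj q(2) p q(1)] .
    with q(3) show ?thesis by simp
  qed
  then have "(\<Sum>p\<in>?A. ribbon_sign (skew (h p) lam) * g (beads (h p))) = current (int k) g ?X"
    unfolding current_def by (intro sum.cong refl) (auto simp: h(2) hop_def ann_def cre_def)
  then show "(\<Sum>mu\<in>ribbon_extensions lam k. ribbon_sign (skew mu lam) * g (beads mu))
      = current (int k) g (beads lam)"
    using sum.reindex_bij_betw[OF bij, of "\<lambda>mu. ribbon_sign (skew mu lam) * g (beads mu)"] by simp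
qed

section \<open>Signed counts of ribbon tableaux\<close>

text \<open>The ribbon tableaux with a given content, the content being listed from the last
  ribbon to the first.\<close>

fun tabs :: "nat list \<Rightarrow> nat list list set" where
  "tabs [] = {[[]]}"
| "tabs (k # ks) = (\<lambda>(P, mu). P @ [mu]) ` (SIGMA P:tabs ks. ribbon_extensions (last P) k)"

lemma ribbon_tableau_Nil: "ribbon_tableau P lam 0 \<longleftrightarrow> P = [[]] \<and> lam = []"
  by (auto simp: ribbon_tableau_def length_Suc_conv is_partition_def)

text \<open>Inserting the actual size of the last ribbon turns \<open>ribbon_extensions\<close> into
  a condition that does not prescribe the size.\<close>

lemma ribbon_tableau_snoc:
  "ribbon_tableau (P @ [mu]) lam (Suc l) \<longleftrightarrow> ribbon_tableau P (last P) l
    \<and> mu \<in> ribbon_extensions (last P) (card (skew mu (last P))) \<and> lam = mu"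
proof (cases "length P = Suc l")
  case True
  then have last: "P ! l = last P" by (metis diff_Suc_1 last_conv_nth length_0_conv nat.distinct(1))
  have nth: "(P @ [mu]) ! i = P ! i" if "i \<le> l" for i using that True by (simp add: nth_append)
  have at_end: "(P @ [mu]) ! Suc l = mu" using True by (simp add: nth_append)
  have "skew mu (last P) \<noteq> {}" if "diagram (last P) \<subset> diagram mu" using that by (auto simp: skew_def)
  then show ?thesis using True
    by (auto simp: ribbon_tableau_def ribbon_extensions_def le_Suc_eq less_Suc_eq nth at_end last
        all_conj_distrib imp_conjR dest: less_imp_le)
qed (auto simp: ribbon_tableau_def)

lemma tableau_content_snoc:
  assumes "P \<noteq> []"
  shows "tableau_content (P @ [mu]) = tableau_content P @ [card (skew mu (last P))]"
proof -
  obtain l where l: "length P = Suc l" using assms by (cases P) auto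
  then have last: "P ! l = last P" using assms by (simp add: last_conv_nth)
  show ?thesis
    by (auto simp: tableau_content_def tableau_ribbon_def l nth_append last)
qed

lemma tableau_sign_snoc:
  assumes "P \<noteq> []"
  shows "tableau_sign (P @ [mu]) = tableau_sign P * ribbon_sign (skew mu (last P))"
proof -
  obtain l where l: "length P = Suc l" using assms by (cases P) auto
  then have last: "P ! l = last P" using assms by (simp add: last_conv_nth)
  show ?thesis
    by (auto simp: tableau_sign_def tableau_ribbon_def l nth_append last lessThan_Suc intro!: prod.cong)
qed

lemma mem_tabs_iff:
  "P \<in> tabs ks \<longleftrightarrow> ribbon_tableau P (last P) (length ks) \<and> tableau_content P = rev ks"
proof (induction ks arbitrary: P)
  case Nil
  then show ?case by (auto simp: ribbon_tableau_Nil tableau_content_def)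
next
  case (Cons k ks)
  show ?case
  proof (cases P rule: rev_cases)
    case Nil
    then show ?thesis by (auto simp: ribbon_tableau_def)
  next
    case (snoc P' mu)
    have ne: "P' \<noteq> []" if "ribbon_tableau P' (last P') (length ks)"
      using that by (auto simp: ribbon_tableau_def)
    have "P \<in> tabs (k # ks) \<longleftrightarrow> P' \<in> tabs ks \<and> mu \<in> ribbon_extensions (last P') k"
      using snoc by auto
    also have "\<dots> \<longleftrightarrow> ribbon_tableau P' (last P') (length ks) \<and> tableau_content P' = rev ks
        \<and> mu \<in> ribbon_extensions (last P') (card (skew mu (last P'))) \<and> card (skew mu (last P')) = k"
      unfolding Cons.IH by (auto simp: ribbon_extensions_def)
    also have "\<dots> \<longleftrightarrow> ribbon_tableau P (last P) (length (k # ks)) \<and> tableau_content P = rev (k # ks)"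
      using snoc ne by (auto simp: ribbon_tableau_snoc tableau_content_snoc)
    finally show ?thesis .
  qed
qed

lemma tabs_last_partition: "P \<in> tabs ks \<Longrightarrow> is_partition (last P)"
  unfolding mem_tabs_iff by (auto simp: ribbon_tableau_def)

lemma tabs_nonempty: "P \<in> tabs ks \<Longrightarrow> P \<noteq> []"
  unfolding mem_tabs_iff by (auto simp: ribbon_tableau_def)

lemma finite_diagram: "finite (diagram lam)"
  unfolding diagram_def
  by (rule finite_subset[of _ "SIGMA i:{..<length lam}. {..<lam ! i}"]) auto

lemma ribbon_extensions_pos: "mu \<in> ribbon_extensions lam k \<Longrightarrow> k > 0"
  using finite_diagram[of mu] by (auto simp: ribbon_extensions_def skew_def card_gt_0_iff)

lemma finite_tabs: "finite (tabs ks)"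
proof (induction ks)
  case (Cons k ks)
  have "finite (ribbon_extensions (last P) k)" if "P \<in> tabs ks" for P
  proof (cases "k > 0")
    case True
    then show ?thesis using sum_ribbon_extensions(1) tabs_last_partition[OF that] by blast
  next
    case False
    then have "ribbon_extensions (last P) k = {}" using ribbon_extensions_pos by blast
    then show ?thesis by simp
  qed
  then show ?case using Cons by (simp add: finite_SigmaI)
qed simp

lemma tabs_pos: "P \<in> tabs ks \<Longrightarrow> 0 \<notin> set ks"
  by (induction ks arbitrary: P) (auto dest: ribbon_extensions_pos)

lemma psize_tabs: "P \<in> tabs ks \<Longrightarrow> psize (last P) = sum_list ks"
proof (induction ks arbitrary: P)
  case (Cons k ks)
  then obtain P' mu where P: "P = P' @ [mu]" "P' \<in> tabs ks" "mu \<in> ribbon_extensions (last P') k" by auto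
  then have "card (diagram mu - diagram (last P')) = k" "diagram (last P') \<subseteq> diagram mu"
    by (auto simp: ribbon_extensions_def skew_def)
  then have "card (diagram mu) = k + card (diagram (last P'))"
    using card_mono[OF finite_diagram, of "diagram (last P')" mu]
    by (simp add: card_Diff_subset finite_diagram)
  then show ?case using Cons.IH[OF P(2)] P(1) by (simp add: psize_def)
qed (simp add: psize_def diagram_def)

text \<open>Summing over the last ribbon replaces \<open>g\<close> by its current, and the induction
  continues with the shorter tableaux.\<close>

lemma sum_tabs:
  assumes "0 \<notin> set ks"
  shows "(\<Sum>P\<in>tabs ks. tableau_sign P * g (beads (last P))) = lower ks g"
  using assms
proof (induction ks arbitrary: g)
  case Nil
  then show ?case by (simp add: tableau_sign_def beads_Nil)
next
  case (Cons k ks)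
  have inj: "inj_on (\<lambda>(P, mu). P @ [mu]) X" for X :: "(nat list list \<times> nat list) set"
    by (auto intro: inj_onI)
  have fin: "\<forall>P\<in>tabs ks. finite (ribbon_extensions (last P) k)"
    using Cons.prems sum_ribbon_extensions(1) tabs_last_partition by auto
  have "(\<Sum>P\<in>tabs (k # ks). tableau_sign P * g (beads (last P)))
      = (\<Sum>(P, mu)\<in>(SIGMA P:tabs ks. ribbon_extensions (last P) k).
          tableau_sign (P @ [mu]) * g (beads mu))"
    unfolding tabs.simps by (subst sum.reindex[OF inj]) (auto intro!: sum.cong)
  also have "\<dots> = (\<Sum>P\<in>tabs ks. \<Sum>mu\<in>ribbon_extensions (last P) k. tableau_sign (P @ [mu]) * g (beads mu))"
    by (rule sum.Sigma[OF finite_tabs fin, symmetric])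
  also have "\<dots> = (\<Sum>P\<in>tabs ks. tableau_sign P * current (int k) g (beads (last P)))"
  proof (rule sum.cong[OF refl])
    fix P assume P: "P \<in> tabs ks"
    have "(\<Sum>mu\<in>ribbon_extensions (last P) k. tableau_sign (P @ [mu]) * g (beads mu))
        = tableau_sign P * (\<Sum>mu\<in>ribbon_extensions (last P) k. ribbon_sign (skew mu (last P)) * g (beads mu))"
      by (simp add: tableau_sign_snoc[OF tabs_nonempty[OF P]] sum_distrib_left mult.assoc)
    also have "\<dots> = tableau_sign P * current (int k) g (beads (last P))"
      using sum_ribbon_extensions(2)[OF tabs_last_partition[OF P]] Cons.prems by simp
    finally show "(\<Sum>mu\<in>ribbon_extensions (last P) k. tableau_sign (P @ [mu]) * g (beads mu))
        = tableau_sign P * current (int k) g (beads (last P))" .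
  qed
  also have "\<dots> = lower (k # ks) g" using Cons by simp
  finally show ?case .
qed

section \<open>Adjointness of adding and removing ribbons\<close>

definition moved :: "int \<Rightarrow> int set \<Rightarrow> int \<Rightarrow> int set" where
  "moved c X p = insert (p + c) (X - {p})"

lemma current_moved:
  "c \<noteq> 0 \<Longrightarrow> current c f X
    = (\<Sum>p | p \<in> X \<and> p + c \<notin> X. sg p X * sg (p + c) (X - {p}) * f (moved c X p))"
  unfolding current_def by (intro sum.cong) (auto simp: hop_def ann_def cre_def moved_def)

lemma maya_moved: "maya X \<Longrightarrow> maya (moved c X p)"
  by (simp add: moved_def)

text \<open>Currents of opposite index are transposes: a move from \<open>Y\<close> to
  \<open>X\<close> is undone by the opposite move, with the same sign.\<close>

lemma current_indicator:
  assumes X: "maya X" and Y: "maya Y" and c: "c \<noteq> 0"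
  shows "current c (\<lambda>Z. if Z = X then 1 else 0) Y
    = (\<Sum>q | q \<in> X \<and> q + - c \<notin> X. sg q X * sg (q + - c) (X - {q}) * (if Y = moved (- c) X q then 1 else 0))"
proof -
  let ?P = "{p. p \<in> Y \<and> p + c \<notin> Y \<and> moved c Y p = X}"
  let ?Q = "{q. q \<in> X \<and> q + - c \<notin> X \<and> Y = moved (- c) X q}"
  have fwd: "p + c \<in> ?Q" "sg (p + c) X * sg (p + c + - c) (X - {p + c}) = sg p Y * sg (p + c) (Y - {p})"
    if "p \<in> ?P" for p
  proof -
    from that have p: "p \<in> Y" "p + c \<notin> Y" "X = insert (p + c) (Y - {p})" by (auto simp: moved_def)
    then show "p + c \<in> ?Q" using c by (auto simp: moved_def)
    have "maya (Y - {p})" using Y by simp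
    note sg = sg_insert[OF this]
    \<comment> \<open>Both signs can be read off the common configuration \<open>Y - {p}\<close>, as
      a bead at a place does not count towards the sign of that place.\<close>
    have "sg p Y = sg p (Y - {p})" using sg[of p p] p by (simp add: insert_absorb)
    moreover have "sg (p + c) X = sg (p + c) (Y - {p})" using sg[of "p + c" "p + c"] p by simp
    moreover have "X - {p + c} = Y - {p}" using p by auto
    ultimately show "sg (p + c) X * sg (p + c + - c) (X - {p + c}) = sg p Y * sg (p + c) (Y - {p})" by simp
  qed
  have bwd: "q - c \<in> ?P" if "q \<in> ?Q" for q
  proof -
    from that have q: "q \<in> X" "q - c \<notin> X" "Y = insert (q - c) (X - {q})" by (auto simp: moved_def)
    then show "q - c \<in> ?P" using c by (auto simp: moved_def)
  qed
  have "current c (\<lambda>Z. if Z = X then 1 else 0) Y = (\<Sum>p\<in>?P. sg p Y * sg (p + c) (Y - {p}))"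
    unfolding current_moved[OF c]
    by (rule sum.mono_neutral_cong_right) (auto simp: finite_movable[OF Y])
  also have "\<dots> = (\<Sum>q\<in>?Q. sg q X * sg (q + - c) (X - {q}))"
    by (rule sum.reindex_bij_witness[of _ "\<lambda>q. q - c" "\<lambda>p. p + c"])
      (use fwd bwd in \<open>simp_all only: diff_add_cancel add_diff_cancel\<close>)
  also have "\<dots> = (\<Sum>q | q \<in> X \<and> q + - c \<notin> X.
      sg q X * sg (q + - c) (X - {q}) * (if Y = moved (- c) X q then 1 else 0))"
    using finite_movable[OF X, of "- c"]
    by (intro sum.mono_neutral_cong_left) auto
  finally show ?thesis .
qed

lemma lower_sum: "lower ks (\<lambda>Y. \<Sum>q\<in>S. F q Y) = (\<Sum>q\<in>S. lower ks (F q))"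
proof (induction ks arbitrary: F)
  case (Cons k ks)
  have "current (int k) (\<lambda>Y. \<Sum>q\<in>S. F q Y) = (\<lambda>X. \<Sum>q\<in>S. current (int k) (F q) X)"
    unfolding current_def hop_sum by (rule ext) (rule sum.swap)
  then show ?case using Cons by simp
qed simp

text \<open>Adding ribbons and removing ribbons are adjoint to each other.\<close>

lemma lower_indicator:
  assumes "0 \<notin> set ks" "maya X"
  shows "lower ks (\<lambda>Y. if Y = X then 1 else 0) = amp ks X"
  using assms
proof (induction ks arbitrary: X)
  case (Cons k ks)
  let ?Q = "{q. q \<in> X \<and> q + - int k \<notin> X}"
  let ?s = "\<lambda>q. sg q X * sg (q + - int k) (X - {q})"
  have k: "int k \<noteq> 0" using Cons.prems by auto
  have "lower (k # ks) (\<lambda>Y. if Y = X then 1 else 0)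
      = lower ks (\<lambda>Y. \<Sum>q\<in>?Q. ?s q * (if Y = moved (- int k) X q then 1 else 0))"
    unfolding lower.simps by (intro lower_cong current_indicator Cons.prems k)
  also have "\<dots> = (\<Sum>q\<in>?Q. ?s q * lower ks (\<lambda>Y. if Y = moved (- int k) X q then 1 else 0))"
    unfolding lower_sum lower_mult ..
  also have "\<dots> = (\<Sum>q\<in>?Q. ?s q * amp ks (moved (- int k) X q))"
    using Cons by (intro sum.cong refl) (simp add: maya_moved)
  also have "\<dots> = amp (k # ks) X" using k by (simp add: current_moved)
  finally show ?case .
qed auto

text \<open>For fixed \<open>P\<close>, summing over \<open>Q\<close> of the same shape is
  \<open>lower ms\<close> of an indicator, which is an amplitude by adjointness; summing over
  \<open>P\<close> then gives the expectation value \<open>lower ks (amp ms)\<close>.\<close>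

lemma sum_tabs_pairs:
  assumes "0 \<notin> set ks" "0 \<notin> set ms"
  shows "(\<Sum>(P, Q) | P \<in> tabs ks \<and> Q \<in> tabs ms \<and> last P = last Q. tableau_sign P * tableau_sign Q)
    = int (prod_list ks * pairings ks (mset ms))"
proof -
  have "{(P, Q). P \<in> tabs ks \<and> Q \<in> tabs ms \<and> last P = last Q}
      = (SIGMA P:tabs ks. {Q \<in> tabs ms. last P = last Q})" by auto
  then have "(\<Sum>(P, Q) | P \<in> tabs ks \<and> Q \<in> tabs ms \<and> last P = last Q. tableau_sign P * tableau_sign Q)
      = (\<Sum>P\<in>tabs ks. \<Sum>Q | Q \<in> tabs ms \<and> last P = last Q. tableau_sign P * tableau_sign Q)"
    using sum.Sigma[of "tabs ks" "\<lambda>P. {Q \<in> tabs ms. last P = last Q}" "\<lambda>P Q. tableau_sign P * tableau_sign Q"]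
    by (simp add: finite_tabs)
  also have "\<dots> = (\<Sum>P\<in>tabs ks. tableau_sign P * amp ms (beads (last P)))"
  proof (rule sum.cong[OF refl])
    fix P assume P: "P \<in> tabs ks"
    \<comment> \<open>Equality of shapes is expressed through bead sets, by
      \<open>beads_inject\<close>, so that \<open>sum_tabs\<close> applies.\<close>
    have "(\<Sum>Q | Q \<in> tabs ms \<and> last P = last Q. tableau_sign P * tableau_sign Q)
        = (\<Sum>Q\<in>tabs ms. tableau_sign P * (tableau_sign Q * (if beads (last Q) = beads (last P) then 1 else 0)))"
      using beads_inject[OF tabs_last_partition[OF P]] tabs_last_partition
      by (intro sum.mono_neutral_cong_left) (auto simp: finite_tabs)
    also have "\<dots> = tableau_sign P * lower ms (\<lambda>Y. if Y = beads (last P) then 1 else 0)"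
      unfolding sum_tabs[OF assms(2), symmetric] sum_distrib_left ..
    finally show "(\<Sum>Q | Q \<in> tabs ms \<and> last P = last Q. tableau_sign P * tableau_sign Q)
        = tableau_sign P * amp ms (beads (last P))"
      using lower_indicator[OF assms(2) maya_beads[OF tabs_last_partition[OF P]]] by simp
  qed
  also have "\<dots> = lower ks (amp ms)" by (rule sum_tabs[OF assms(1)])
  finally show ?thesis using lower_amp[OF assms] by simp
qed

section \<open>Counting hook permutations\<close>

text \<open>Each factor is nonzero only if the part is present, so all of \<open>M\<close> is used
  up exactly.\<close>

lemma mset_eq_of_pairings_neq_0: "pairings ks M \<noteq> 0 \<Longrightarrow> mset ks = M"
proof (induction ks arbitrary: M)
  case (Cons k ks)
  then have "count M k \<noteq> 0" "mset ks = M - {#k#}" by auto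
  then show ?case by (simp add: count_eq_zero_iff)
qed (simp split: if_splits)

text \<open>The head is any element of \<open>J\<close> with label \<open>k\<close>; deleting it
  reproduces the recursion of \<open>pairings\<close>.\<close>

lemma card_distinct_lists:
  assumes "finite J"
  shows "card {xs. distinct xs \<and> set xs = J \<and> map g xs = ks} = pairings ks (image_mset g (mset_set J))"
  using assms
proof (induction ks arbitrary: J)
  case Nil
  have "{xs. distinct xs \<and> set xs = J \<and> map g xs = []} = (if J = {} then {[]} else {})" by auto
  then show ?case using Nil by (simp add: mset_set_empty_iff)
next
  case (Cons k ks)
  let ?L = "\<lambda>J ks. {xs. distinct xs \<and> set xs = J \<and> map g xs = ks}"
  let ?J = "{j \<in> J. g j = k}"
  have finL: "finite (?L J' ks')" if "finite J'" for J' ks'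
    by (rule finite_subset[OF _ finite_lists_length_eq[OF that, of "length ks'"]]) auto
  have "?L J (k # ks) = (\<Union>j\<in>?J. (#) j ` ?L (J - {j}) ks)"
  proof (intro equalityI subsetI)
    fix xs assume xs: "xs \<in> ?L J (k # ks)"
    then obtain j ys where "xs = j # ys" by (cases xs) auto
    moreover from this xs have "ys \<in> ?L (J - {j}) ks" "j \<in> ?J" by auto
    ultimately show "xs \<in> (\<Union>j\<in>?J. (#) j ` ?L (J - {j}) ks)" by blast
  next
    fix xs assume "xs \<in> (\<Union>j\<in>?J. (#) j ` ?L (J - {j}) ks)"
    then obtain j ys where j: "j \<in> J" "g j = k" and ys: "distinct ys" "set ys = J - {j}" "map g ys = ks"
      and xs: "xs = j # ys" by blast
    have "set xs = J" using xs ys(2) j(1) by (simp add: insert_absorb)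
    then show "xs \<in> ?L J (k # ks)" using xs ys j by simp
  qed
  then have "card (?L J (k # ks)) = (\<Sum>j\<in>?J. card ((#) j ` ?L (J - {j}) ks))"
    by (simp only:) (rule card_UN_disjoint, use Cons.prems finL in auto)
  also have "\<dots> = (\<Sum>j\<in>?J. pairings ks (image_mset g (mset_set J) - {#k#}))"
  proof (intro sum.cong refl)
    fix j assume j: "j \<in> ?J"
    have "image_mset g (mset_set (J - {j})) = image_mset g (mset_set J) - {#k#}"
      using j Cons.prems by (simp add: mset_set_Diff image_mset_Diff)
    then show "card ((#) j ` ?L (J - {j}) ks) = pairings ks (image_mset g (mset_set J) - {#k#})"
      using Cons by (simp add: card_image)
  qed
  also have "\<dots> = pairings (k # ks) (image_mset g (mset_set J))"
  proof -
    have "g -` {k} \<inter> J = ?J" by auto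
    moreover have "sum (count (mset_set J)) ?J = card ?J" using Cons.prems by simp
    ultimately have "count (image_mset g (mset_set J)) k = card ?J"
      using Cons.prems by (simp only: count_image_mset finite_set_mset_mset_set)
    then show ?thesis by simp
  qed
  finally show ?case .
qed

text \<open>Reversing an ordering reverses its word of labels. This compensates for
  \<open>tabs\<close> listing contents backwards.\<close>

lemma pairings_rev: "pairings (rev ks) (mset ms) = pairings ks (mset ms)"
proof -
  \<comment> \<open>Positions serve as elements, so that equal parts of \<open>ms\<close> stay
    distinguishable.\<close>
  define g where "g i = ms ! i" for i
  define J where "J = {..<length ms}"
  have "map g [0..<length ms] = ms" by (rule nth_equalityI) (simp_all add: g_def)
  then have M: "image_mset g (mset_set J) = mset ms"
    using mset_map[of g "[0..<length ms]"] by (simp add: J_def lessThan_atLeast0)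
  have "{xs. distinct xs \<and> set xs = J \<and> map g xs = rev ks}
      = rev ` {xs. distinct xs \<and> set xs = J \<and> map g xs = ks}"
  proof (intro equalityI subsetI)
    fix xs assume "xs \<in> {xs. distinct xs \<and> set xs = J \<and> map g xs = rev ks}"
    then have "rev xs \<in> {xs. distinct xs \<and> set xs = J \<and> map g xs = ks}"
      by (simp add: rev_map[symmetric])
    then show "xs \<in> rev ` {xs. distinct xs \<and> set xs = J \<and> map g xs = ks}"
      by (metis imageI rev_rev_ident)
  qed (clarsimp simp: rev_map[symmetric])
  then have "card {xs. distinct xs \<and> set xs = J \<and> map g xs = rev ks}
      = card {xs. distinct xs \<and> set xs = J \<and> map g xs = ks}"
    by (simp only: card_image[OF inj_on_rev])
  moreover have "finite J" by (simp add: J_def)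
  ultimately show ?thesis by (simp only: card_distinct_lists M)
qed

text \<open>A permutation is encoded by its word of values, an ordering of \<open>{1..l}\<close>
  labelled by the entries of \<open>ms\<close>.\<close>

lemma card_permutes_map:
  assumes "length ms = l"
  shows "card {\<sigma>. \<sigma> permutes {1..l} \<and> map (\<lambda>i. ms ! (\<sigma> i - 1)) [1..<Suc l] = ks}
    = pairings ks (mset ms)"
proof -
  let ?S = "{\<sigma>. \<sigma> permutes {1..l} \<and> map (\<lambda>i. ms ! (\<sigma> i - 1)) [1..<Suc l] = ks}"
  let ?L = "{xs. distinct xs \<and> set xs = {1..l} \<and> map (\<lambda>j. ms ! (j - 1)) xs = ks}"
  have "bij_betw (\<lambda>\<sigma>. map \<sigma> [1..<Suc l]) ?S ?L"
    unfolding bij_betw_def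
  proof
    show "inj_on (\<lambda>\<sigma>. map \<sigma> [1..<Suc l]) ?S"
    proof (rule inj_onI)
      fix \<sigma> \<tau> assume *: "\<sigma> \<in> ?S" "\<tau> \<in> ?S" "map \<sigma> [1..<Suc l] = map \<tau> [1..<Suc l]"
      show "\<sigma> = \<tau>"
      proof
        fix i
        show "\<sigma> i = \<tau> i"
        proof (cases "i \<in> {1..l}")
          case True
          then have "i \<in> set [1..<Suc l]" by auto
          then show ?thesis using *(3) by (metis map_eq_conv)
        next
          case False
          then show ?thesis using * by (auto simp: permutes_not_in)
        qed
      qed
    qed
    show "(\<lambda>\<sigma>. map \<sigma> [1..<Suc l]) ` ?S = ?L"
    proof (intro equalityI subsetI)
      fix xs assume "xs \<in> (\<lambda>\<sigma>. map \<sigma> [1..<Suc l]) ` ?S"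
      then obtain \<sigma> where \<sigma>: "\<sigma> permutes {1..l}" "map (\<lambda>i. ms ! (\<sigma> i - 1)) [1..<Suc l] = ks"
        and xs: "xs = map \<sigma> [1..<Suc l]" by auto
      have "set xs = \<sigma> ` {1..l}" using xs by (auto simp del: upt_Suc)
      moreover have "distinct xs"
        using permutes_inj_on[OF \<sigma>(1)] xs by (simp add: distinct_map del: upt_Suc)
      moreover have "map (\<lambda>j. ms ! (j - 1)) xs = ks" using \<sigma>(2) xs by (simp add: comp_def del: upt_Suc)
      ultimately show "xs \<in> ?L" using permutes_image[OF \<sigma>(1)] by simp
    next
      fix xs assume "xs \<in> ?L"
      then have xs: "distinct xs" "set xs = {1..l}" "map (\<lambda>j. ms ! (j - 1)) xs = ks" by auto
      have len: "length xs = l" using distinct_card[OF xs(1)] xs(2) by simp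
      \<comment> \<open>The word fixes the values on \<open>{1..l}\<close>; \<open>permutes\<close>
        demands the identity elsewhere.\<close>
      define \<sigma> where "\<sigma> i = (if i \<in> {1..l} then xs ! (i - 1) else i)" for i
      have map\<sigma>: "map \<sigma> [1..<Suc l] = xs"
        by (rule nth_equalityI) (auto simp: len \<sigma>_def simp del: upt_Suc)
      have "bij_betw \<sigma> {1..l} {1..l}"
        unfolding bij_betw_def
      proof
        have "set (map \<sigma> [1..<Suc l]) = {1..l}" unfolding map\<sigma> by (rule xs(2))
        then show "\<sigma> ` {1..l} = {1..l}" by (simp add: atLeastLessThanSuc_atLeastAtMost del: upt_Suc)
        have "distinct (map \<sigma> [1..<Suc l])" unfolding map\<sigma> by (rule xs(1))
        then show "inj_on \<sigma> {1..l}" by (simp add: distinct_map atLeastLessThanSuc_atLeastAtMost del: upt_Suc)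
      qed
      then have "\<sigma> permutes {1..l}" by (rule bij_imp_permutes) (auto simp: \<sigma>_def)
      moreover have "map (\<lambda>i. ms ! (\<sigma> i - 1)) [1..<Suc l] = ks"
        using arg_cong[OF map\<sigma>, of "map (\<lambda>j. ms ! (j - 1))"] xs(3) by (simp add: comp_def del: upt_Suc)
      ultimately show "xs \<in> (\<lambda>\<sigma>. map \<sigma> [1..<Suc l]) ` ?S" using map\<sigma> by (intro image_eqI[of _ _ \<sigma>]) auto
    qed
  qed
  then have "card ?S = card ?L" by (rule bij_betw_same_card)
  also have "\<dots> = pairings ks (image_mset (\<lambda>j. ms ! (j - 1)) (mset_set {1..l}))"
    by (rule card_distinct_lists) simp
  also have "image_mset (\<lambda>j. ms ! (j - 1)) (mset_set {1..l}) = mset (map (\<lambda>j. ms ! (j - 1)) [1..<Suc l])"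
    by (simp add: atLeastLessThanSuc_atLeastAtMost del: upt_Suc)
  also have "map (\<lambda>j. ms ! (j - 1)) [1..<Suc l] = ms"
    by (rule nth_equalityI) (auto simp: assms simp del: upt_Suc)
  finally show ?thesis .
qed

section \<open>Counting sequences of hooks\<close>

lemma psize_eq_sum_list: "psize lam = sum_list lam"
proof -
  have "diagram lam = (SIGMA i:{..<length lam}. {..<lam ! i})" by (auto simp: diagram_def)
  then show ?thesis by (simp add: psize_def sum_list_sum_nth lessThan_atLeast0)
qed

lemma psize_hook_pos: "is_hook h \<Longrightarrow> psize h > 0"
  by (auto simp: is_hook_def psize_eq_sum_list)

text \<open>The height \<open>m\<close> ranges over \<open>{..<s}\<close> and determines the first
  row \<open>s - m\<close>. This accounts for the factor \<open>k\<close> of the Heisenberg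
  relation.\<close>

lemma card_hooks: "card {h. is_hook h \<and> psize h = s} = s"
proof -
  have "{h. is_hook h \<and> psize h = s} = (\<lambda>m. (s - m) # replicate m 1) ` {..<s}"
  proof (intro equalityI subsetI)
    fix h assume "h \<in> {h. is_hook h \<and> psize h = s}"
    then obtain k m where "k \<ge> 1" "h = k # replicate m 1" "k + m = s"
      by (auto simp: is_hook_def psize_eq_sum_list sum_list_replicate)
    then show "h \<in> (\<lambda>m. (s - m) # replicate m 1) ` {..<s}" by (intro image_eqI[of _ _ m]) auto
  qed (auto simp: is_hook_def psize_eq_sum_list sum_list_replicate)
  moreover have "inj_on (\<lambda>m. (s - m) # replicate m (1::nat)) {..<s}"
    by (rule inj_onI) (metis length_replicate list.inject)
  ultimately show ?thesis by (simp add: card_image)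
qed

lemma finite_hooks: "finite {h. is_hook h \<and> psize h = s}"
proof (cases "s = 0")
  case True
  then have "{h. is_hook h \<and> psize h = s} = {}" using psize_hook_pos by force
  then show ?thesis by (simp only: finite.emptyI)
next
  case False
  then show ?thesis by (intro card_ge_0_finite) (simp add: card_hooks)
qed

lemma hook_lists:
  "finite {H. (\<forall>h\<in>set H. is_hook h) \<and> map psize H = ms}
    \<and> card {H. (\<forall>h\<in>set H. is_hook h) \<and> map psize H = ms} = prod_list ms"
proof (induction ms)
  case Nil
  have "{H. (\<forall>h\<in>set H. is_hook h) \<and> map psize H = []} = {[]}" by auto
  then show ?case by simp
next
  case (Cons m ms)
  let ?H = "\<lambda>ms. {H. (\<forall>h\<in>set H. is_hook h) \<and> map psize H = ms}"
  have eq: "?H (m # ms) = (\<lambda>(h, H). h # H) ` ({h. is_hook h \<and> psize h = m} \<times> ?H ms)"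
    by (force simp: map_eq_Cons_conv)
  have inj: "inj_on (\<lambda>(h, H). h # H) X" for X :: "(nat list \<times> nat list list) set"
    by (auto intro: inj_onI)
  show ?case unfolding eq
    using Cons finite_hooks by (auto simp: card_image[OF inj] card_cartesian_product card_hooks)
qed

section \<open>From signed counts to signed bijections\<close>

text \<open>Positive elements outnumber negative ones by \<open>card A\<close>. Swapping each
  negative element with a chosen positive partner leaves exactly \<open>card A\<close> fixed points,
  all positive.\<close>

lemma cancelling_involution:
  fixes sB :: "'b \<Rightarrow> int"
  assumes A: "finite A" and B: "finite B" and sB: "\<And>b. b \<in> B \<Longrightarrow> sB b \<in> {1, -1}"
    and sum: "(\<Sum>b\<in>B. sB b) = int (card A)"
  shows "\<exists>i \<phi>. sign_reversing_involution B sB i \<and> bij_betw \<phi> A (Fix_on B i) \<and> (\<forall>a\<in>A. sB (\<phi> a) = 1)"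
proof -
  define Pos Neg where "Pos = {b \<in> B. sB b = 1}" and "Neg = {b \<in> B. sB b = -1}"
  have fin: "finite Pos" "finite Neg" using B by (simp_all add: Pos_def Neg_def)
  have split: "B = Pos \<union> Neg" "Pos \<inter> Neg = {}" using sB by (auto simp: Pos_def Neg_def)
  have "(\<Sum>b\<in>B. sB b) = (\<Sum>b\<in>Pos. sB b) + (\<Sum>b\<in>Neg. sB b)"
    by (subst split(1)) (rule sum.union_disjoint[OF fin split(2)])
  also have "\<dots> = int (card Pos) - int (card Neg)" by (simp add: Pos_def Neg_def)
  finally have card: "card Pos = card Neg + card A" using sum by simp
  then obtain N where N: "N \<subseteq> Pos" "card N = card Neg"
    using obtain_subset_with_card_n[of "card Neg" Pos] by auto
  have "finite N" using N(1) fin(1) by (rule finite_subset)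
  then obtain h where h: "bij_betw h Neg N"
    using finite_same_card_bij[OF fin(2)] N(2) by metis
  have "card (Pos - N) = card A"
    using N card \<open>finite N\<close> by (simp add: card_Diff_subset)
  then obtain \<phi> where \<phi>: "bij_betw \<phi> A (Pos - N)"
    using finite_same_card_bij[OF A, of "Pos - N"] fin by auto
  define i where "i b = (if b \<in> Neg then h b else if b \<in> N then inv_into Neg h b else b)" for b
  have Neg: "i b \<in> N" "i (i b) = b" if "b \<in> Neg" for b
  proof -
    have hb: "h b \<in> N" using h that by (auto simp: bij_betw_def)
    then have "h b \<notin> Neg" using N(1) split(2) by auto
    then show "i b \<in> N" "i (i b) = b"
      using that hb bij_betw_inv_into_left[OF h that] by (simp_all add: i_def)
  qed
  have N': "i b \<in> Neg" "i (i b) = b" if "b \<in> N" for b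
  proof -
    have b: "b \<notin> Neg" using that N(1) split(2) by auto
    have g: "inv_into Neg h b \<in> Neg" "h (inv_into Neg h b) = b"
      using h that by (auto simp: bij_betw_def inv_into_into f_inv_into_f)
    then show "i b \<in> Neg" "i (i b) = b" using that b by (simp_all add: i_def)
  qed
  have other: "i b = b" if "b \<notin> Neg" "b \<notin> N" for b using that by (simp add: i_def)
  have sN: "sB b = 1" if "b \<in> N" for b using that N(1) by (auto simp: Pos_def)
  have sNeg: "sB b = -1" if "b \<in> Neg" for b using that by (auto simp: Neg_def)
  have NegB: "Neg \<subseteq> B" "N \<subseteq> B" using split(1) N(1) by auto
  have inv: "sign_reversing_involution B sB i"
    unfolding sign_reversing_involution_def
  proof (intro conjI ballI)
    fix b assume "b \<in> B"
    then consider "b \<in> Neg" | "b \<in> N" | "b \<in> B" "b \<notin> Neg" "b \<notin> N" by blast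
    then have "i b \<in> B \<and> i (i b) = b"
    proof cases
      case 1
      then show ?thesis using Neg NegB(2) by blast
    next
      case 2
      then show ?thesis using N' NegB(1) by blast
    qed (simp add: other)
    then show "i b \<in> B" "i (i b) = b" by simp_all
  next
    fix b assume "b \<in> B - Fix_on B i"
    then have "i b \<noteq> b" by (auto simp: Fix_on_def)
    then have "b \<in> Neg \<or> b \<in> N" using other by blast
    then show "sB (i b) = - sB b"
      using Neg(1)[of b] N'(1)[of b] sN sNeg by auto
  qed
  have "Fix_on B i = Pos - N"
  proof (intro set_eqI iffI)
    fix b assume "b \<in> Fix_on B i"
    then have b: "b \<in> B" "i b = b" by (auto simp: Fix_on_def)
    have "b \<notin> Neg"
    proof
      assume "b \<in> Neg"
      with Neg(1)[of b] b(2) N(1) split(2) show False by auto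
    qed
    moreover have "b \<notin> N"
    proof
      assume "b \<in> N"
      with N'(1)[of b] b(2) N(1) split(2) show False by auto
    qed
    ultimately show "b \<in> Pos - N" using b split(1) by auto
  next
    fix b assume "b \<in> Pos - N"
    then show "b \<in> Fix_on B i" using other[of b] split by (auto simp: Fix_on_def)
  qed
  then have "bij_betw \<phi> A (Fix_on B i)" using \<phi> by simp
  moreover have "sB (\<phi> a) = 1" if "a \<in> A" for a
    using \<phi> that by (auto simp: bij_betw_def Pos_def)
  ultimately show ?thesis using inv by blast
qed

text \<open>The involutions and bijections chosen on the single classes are glued; since each stays
  within its class, the class is preserved.\<close>

lemma classwise_cancelling_involution:
  fixes sB :: "'b \<Rightarrow> int" and cB :: "'b \<Rightarrow> 'c"
  assumes A: "finite A" and B: "finite B" and sB: "\<And>b. b \<in> B \<Longrightarrow> sB b \<in> {1, -1}"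
    and sum: "\<And>c. (\<Sum>b | b \<in> B \<and> cB b = c. sB b) = int (card {a \<in> A. cA a = c})"
  shows "\<exists>i \<phi>. sign_reversing_involution B sB i \<and> bij_betw \<phi> A (Fix_on B i)
    \<and> (\<forall>a\<in>A. sB (\<phi> a) = 1) \<and> (\<forall>b\<in>B. cB (i b) = cB b) \<and> (\<forall>a\<in>A. cB (\<phi> a) = cA a)"
proof -
  let ?A = "\<lambda>c. {a \<in> A. cA a = c}" and ?B = "\<lambda>c. {b \<in> B. cB b = c}"
  let ?P = "\<lambda>c i \<phi>. sign_reversing_involution (?B c) sB i \<and> bij_betw \<phi> (?A c) (Fix_on (?B c) i)
      \<and> (\<forall>a\<in>?A c. sB (\<phi> a) = 1)"
  have ex: "\<exists>i \<phi>. ?P c i \<phi>" for c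
    using A B sB sum[of c] by (intro cancelling_involution) auto
  have "\<exists>i. \<forall>c. \<exists>\<phi>. ?P c (i c) \<phi>" by (rule choice, rule allI, rule ex)
  then obtain i where i': "\<forall>c. \<exists>\<phi>. ?P c (i c) \<phi>" ..
  have "\<exists>\<phi>. \<forall>c. ?P c (i c) (\<phi> c)" by (rule choice, rule i')
  then obtain \<phi> where P: "\<forall>c. ?P c (i c) (\<phi> c)" ..
  have i: "sign_reversing_involution (?B c) sB (i c)" for c
    using P[rule_format, of c] by (rule conjunct1)
  have \<phi>: "bij_betw (\<phi> c) (?A c) (Fix_on (?B c) (i c))" "\<forall>a\<in>?A c. sB (\<phi> c a) = 1" for c
    using P[rule_format, of c, THEN conjunct2] by (rule conjunct1, rule conjunct2)
  define I where "I b = i (cB b) b" for b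
  define F where "F a = \<phi> (cA a) a" for a
  have I: "I b \<in> B" "cB (I b) = cB b" "I (I b) = b" "I b \<noteq> b \<Longrightarrow> sB (I b) = - sB b" if "b \<in> B" for b
  proof -
    have b: "b \<in> ?B (cB b)" using that by simp
    from i[of "cB b"] b show 1: "I b \<in> B" and 2: "cB (I b) = cB b"
      unfolding sign_reversing_involution_def I_def by blast+
    have "i (cB b) (i (cB b) b) = b"
      using i[of "cB b"] b unfolding sign_reversing_involution_def by blast
    then show "I (I b) = b" using 2 by (simp add: I_def)
    show "sB (I b) = - sB b" if "I b \<noteq> b"
      using i[of "cB b"] b that unfolding sign_reversing_involution_def I_def Fix_on_def by blast
  qed
  have F: "F a \<in> B" "cB (F a) = cA a" "I (F a) = F a" "sB (F a) = 1" if "a \<in> A" for a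
  proof -
    have a: "a \<in> ?A (cA a)" using that by simp
    then have "F a \<in> Fix_on (?B (cA a)) (i (cA a))"
      using \<phi>(1)[of "cA a"] unfolding F_def by (rule bij_betwE[rule_format, rotated])
    then show "F a \<in> B" and c: "cB (F a) = cA a" and "I (F a) = F a"
      by (auto simp: Fix_on_def I_def)
    show "sB (F a) = 1" using \<phi>(2)[of "cA a"] a unfolding F_def by blast
  qed
  have "sign_reversing_involution B sB I"
    using I by (auto simp: sign_reversing_involution_def Fix_on_def)
  moreover have "bij_betw F A (Fix_on B I)"
    unfolding bij_betw_def
  proof
    show "inj_on F A"
    proof (rule inj_onI)
      fix a a' assume a: "a \<in> A" "a' \<in> A" "F a = F a'"
      then have "cA a = cA a'" using F(2) by metis
      then show "a = a'"
        using a \<phi>(1)[of "cA a"] by (auto simp: bij_betw_def F_def dest: inj_onD)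
    qed
    show "F ` A = Fix_on B I"
    proof
      show "F ` A \<subseteq> Fix_on B I" using F by (auto simp: Fix_on_def)
      show "Fix_on B I \<subseteq> F ` A"
      proof
        fix b assume "b \<in> Fix_on B I"
        then have "b \<in> Fix_on (?B (cB b)) (i (cB b))" by (auto simp: Fix_on_def I_def)
        also have "\<dots> = \<phi> (cB b) ` ?A (cB b)" using \<phi>(1) by (simp add: bij_betw_def)
        finally obtain a where a: "a \<in> A" "cA a = cB b" "b = \<phi> (cB b) a" by blast
        then have "b = F a" by (simp add: F_def)
        with a(1) show "b \<in> F ` A" by blast
      qed
    qed
  qed
  ultimately show ?thesis using F I by blast
qed

text \<open>The size condition is put on \<open>ms\<close> alone, since the common shape forces the
  same sum for \<open>ks\<close>.\<close>

lemma tableau_pairs_class: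
  "{PQ. PQ \<in> tableau_pairs n l \<and> (tableau_content (fst PQ), tableau_content (snd PQ)) = (ks, ms)}
    = (if length ks = l \<and> length ms = l \<and> sum_list ms = n
       then {(P, Q). P \<in> tabs (rev ks) \<and> Q \<in> tabs (rev ms) \<and> last P = last Q} else {})"
  (is "?L = ?R")
proof -
  have *: "ribbon_tableau P lam l \<and> tableau_content P = ks
      \<longleftrightarrow> length ks = l \<and> P \<in> tabs (rev ks) \<and> last P = lam" for P lam ks
  proof -
    have "last P = lam \<and> length P = Suc l \<and> length (tableau_content P) = l" if "ribbon_tableau P lam l"
    proof -
      have P: "length P = Suc l" "P ! l = lam" using that by (auto simp: ribbon_tableau_def)
      then have "P \<noteq> []" by auto
      then show ?thesis using P by (simp add: last_conv_nth tableau_content_def)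
    qed
    then show ?thesis by (auto simp: mem_tabs_iff)
  qed
  have iff: "(P, Q) \<in> tableau_pairs n l \<and> tableau_content P = ks \<and> tableau_content Q = ms
      \<longleftrightarrow> length ks = l \<and> length ms = l \<and> sum_list ms = n
        \<and> P \<in> tabs (rev ks) \<and> Q \<in> tabs (rev ms) \<and> last P = last Q" for P Q
  proof -
    have "(P, Q) \<in> tableau_pairs n l \<and> tableau_content P = ks \<and> tableau_content Q = ms
      \<longleftrightarrow> (\<exists>lam. psize lam = n \<and> (ribbon_tableau P lam l \<and> tableau_content P = ks)
          \<and> (ribbon_tableau Q lam l \<and> tableau_content Q = ms))"
      by (auto simp: tableau_pairs_def)
    also have "\<dots> \<longleftrightarrow> length ks = l \<and> length ms = l \<and> psize (last Q) = n
        \<and> P \<in> tabs (rev ks) \<and> Q \<in> tabs (rev ms) \<and> last P = last Q"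
      unfolding * by auto
    finally show ?thesis using psize_tabs[of Q "rev ms"] by auto
  qed
  show ?thesis
  proof (rule set_eqI)
    fix PQ :: "nat list list \<times> nat list list"
    obtain P Q where "PQ = (P, Q)" by (cases PQ)
    then show "PQ \<in> ?L \<longleftrightarrow> PQ \<in> ?R" using iff[of P Q] by (auto split: if_splits)
  qed
qed

text \<open>Once the sizes \<open>ms\<close> are fixed, the permuted content depends on the
  permutation only, so the class is a product.\<close>

lemma hook_perms_class:
  "{HS. HS \<in> hook_perms n l
      \<and> (hook_perm_content (fst HS) (snd HS), hook_content (fst HS)) = (ks, ms)}
    = (if length ms = l \<and> sum_list ms = n
       then {H. (\<forall>h\<in>set H. is_hook h) \<and> map psize H = ms}
          \<times> {\<sigma>. \<sigma> permutes {1..l} \<and> map (\<lambda>i. ms ! (\<sigma> i - 1)) [1..<Suc l] = ks} else {})"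
  (is "?L = ?R")
proof -
  have "hook_perm_content H \<sigma> = map (\<lambda>i. map psize H ! (\<sigma> i - 1)) [1..<Suc l]"
    if "length H = l" "\<sigma> permutes {1..l}" for H \<sigma>
    unfolding hook_perm_content_def that(1)
  proof (rule map_cong[OF refl])
    fix i assume "i \<in> set [1..<Suc l]"
    then have "i \<in> {1..l}" by auto
    then have "\<sigma> i \<in> {1..l}" using permutes_in_image[OF that(2)] by blast
    then show "psize (H ! (\<sigma> i - 1)) = map psize H ! (\<sigma> i - 1)" using that(1) by auto
  qed
  then have iff: "(H, \<sigma>) \<in> hook_perms n l \<and> hook_perm_content H \<sigma> = ks \<and> hook_content H = ms
    \<longleftrightarrow> length ms = l \<and> sum_list ms = n \<and> (\<forall>h\<in>set H. is_hook h) \<and> map psize H = ms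
      \<and> \<sigma> permutes {1..l} \<and> map (\<lambda>i. ms ! (\<sigma> i - 1)) [1..<Suc l] = ks" for H \<sigma>
    by (auto simp: hook_perms_def hook_content_def simp del: upt_Suc)
  show ?thesis
  proof (rule set_eqI)
    fix HS :: "nat list list \<times> (nat \<Rightarrow> nat)"
    obtain H \<sigma> where "HS = (H, \<sigma>)" by (cases HS)
    then show "HS \<in> ?L \<longleftrightarrow> HS \<in> ?R"
      using iff[of H \<sigma>] by (auto split: if_splits simp del: upt_Suc)
  qed
qed

text \<open>The hooks contribute \<open>prod_list ms\<close>; it may be replaced by
  \<open>prod_list ks\<close> because a nonzero \<open>pairings\<close> makes \<open>ks\<close> a
  rearrangement of \<open>ms\<close>.\<close>

lemma card_hook_class:
  assumes "length ms = l"
  shows "card ({H. (\<forall>h\<in>set H. is_hook h) \<and> map psize H = ms}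
      \<times> {\<sigma>. \<sigma> permutes {1..l} \<and> map (\<lambda>i. ms ! (\<sigma> i - 1)) [1..<Suc l] = ks})
    = prod_list ks * pairings ks (mset ms)"
proof -
  have "prod_list ms = prod_list ks" if "pairings ks (mset ms) \<noteq> 0"
    using mset_eq_of_pairings_neq_0[OF that] by (metis prod_mset_prod_list)
  then show ?thesis
    unfolding card_cartesian_product card_permutes_map[OF assms] conjunct2[OF hook_lists]
    by (cases "pairings ks (mset ms) = 0") auto
qed

lemma sum_tableau_pairs_class:
  "(\<Sum>PQ | PQ \<in> tableau_pairs n l
      \<and> (tableau_content (fst PQ), tableau_content (snd PQ)) = (ks, ms). pair_sign PQ)
    = int (card {HS \<in> hook_perms n l.
        (hook_perm_content (fst HS) (snd HS), hook_content (fst HS)) = (ks, ms)})"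
  unfolding tableau_pairs_class hook_perms_class
proof (cases "length ms = l \<and> sum_list ms = n")
  case True
  let ?B = "{(P, Q). P \<in> tabs (rev ks) \<and> Q \<in> tabs (rev ms) \<and> last P = last Q}"
  have "sum pair_sign (if length ks = l then ?B else {}) = int (prod_list ks * pairings ks (mset ms))"
  proof (cases "length ks = l \<and> 0 \<notin> set ks \<and> 0 \<notin> set ms")
    case True
    have "prod_list (rev ks) = prod_list ks" by (metis mset_rev prod_mset_prod_list)
    moreover have "sum pair_sign ?B = (\<Sum>(P, Q)\<in>?B. tableau_sign P * tableau_sign Q)"
      by (intro sum.cong) (auto simp: pair_sign_def)
    ultimately show ?thesis
      using True sum_tabs_pairs[of "rev ks" "rev ms"] by (simp add: pairings_rev)
  next
    case False
    \<comment> \<open>There are no tableaux here, and the count vanishes as well: a nonzero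
      \<open>pairings\<close> gives \<open>ks\<close> the length and the entries of
      \<open>ms\<close>, so a part 0 occurs in \<open>ks\<close> and kills the product.\<close>
    have "prod_list ks * pairings ks (mset ms) = 0"
    proof (rule ccontr)
      assume nz: "prod_list ks * pairings ks (mset ms) \<noteq> 0"
      then have "mset ks = mset ms" by (intro mset_eq_of_pairings_neq_0) auto
      then have "length ks = length ms" "set ks = set ms" by (metis size_mset, metis set_mset_mset)
      with nz False True show False by (auto simp: prod_list_zero_iff)
    qed
    moreover have "(if length ks = l then ?B else {}) = {}"
      using False tabs_pos[of _ "rev ks"] tabs_pos[of _ "rev ms"] by auto
    ultimately show ?thesis by simp
  qed
  then show "sum pair_sign (if length ks = l \<and> length ms = l \<and> sum_list ms = n then ?B else {})
      = int (card (if length ms = l \<and> sum_list ms = n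
          then {H. (\<forall>h\<in>set H. is_hook h) \<and> map psize H = ms}
            \<times> {\<sigma>. \<sigma> permutes {1..l} \<and> map (\<lambda>i. ms ! (\<sigma> i - 1)) [1..<Suc l] = ks} else {}))"
    using True card_hook_class[of ms l ks] by (simp del: upt_Suc)
qed auto

lemma finite_compositions: "finite {ks. length ks = l \<and> sum_list ks = (n::nat)}"
proof (rule finite_subset)
  show "{ks. length ks = l \<and> sum_list ks = n} \<subseteq> {ks. set ks \<subseteq> {..n} \<and> length ks = l}"
    using member_le_sum_list by fastforce
qed (rule finite_lists_length_eq, simp)

lemma finite_hook_perms: "finite (hook_perms n l)"
proof (rule finite_subset)
  let ?C = "{ks. length ks = l \<and> sum_list ks = n}"
  show "hook_perms n l \<subseteq> (\<Union>ms\<in>?C. {H. (\<forall>h\<in>set H. is_hook h) \<and> map psize H = ms})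
      \<times> {\<sigma>. \<sigma> permutes {1..l}}"
    by (auto simp: hook_perms_def)
  show "finite \<dots>"
    using hook_lists finite_compositions by (auto intro!: finite_cartesian_product finite_permutations)
qed

lemma finite_tableau_pairs: "finite (tableau_pairs n l)"
proof (rule finite_subset)
  let ?C = "{ks. length ks = l \<and> sum_list ks = n}"
  show "tableau_pairs n l \<subseteq> (\<Union>ks\<in>?C. tabs (rev ks)) \<times> (\<Union>ks\<in>?C. tabs (rev ks))"
  proof
    fix PQ assume PQ: "PQ \<in> tableau_pairs n l"
    let ?ks = "tableau_content (fst PQ)" and ?ms = "tableau_content (snd PQ)"
    have "PQ \<in> {PQ. PQ \<in> tableau_pairs n l
        \<and> (tableau_content (fst PQ), tableau_content (snd PQ)) = (?ks, ?ms)}"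
      using PQ by simp
    then have "length ?ks = l \<and> length ?ms = l \<and> sum_list ?ms = n \<and> fst PQ \<in> tabs (rev ?ks)
        \<and> snd PQ \<in> tabs (rev ?ms) \<and> last (fst PQ) = last (snd PQ)"
      unfolding tableau_pairs_class by (auto split: if_splits)
    moreover from this have "sum_list ?ks = n"
      using psize_tabs[of "fst PQ" "rev ?ks"] psize_tabs[of "snd PQ" "rev ?ms"] by simp
    ultimately show "PQ \<in> (\<Union>ks\<in>?C. tabs (rev ks)) \<times> (\<Union>ks\<in>?C. tabs (rev ks))"
      by (auto simp: mem_Times_iff)
  qed
  show "finite ((\<Union>ks\<in>?C. tabs (rev ks)) \<times> (\<Union>ks\<in>?C. tabs (rev ks)))"
    using finite_tabs finite_compositions by (intro finite_cartesian_product finite_UN_I) auto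
qed

lemma pair_sign_values: "pair_sign PQ \<in> {1, -1}"
proof -
  have sgn: "ribbon_sign S \<in> {1, -1}" for S by (simp add: ribbon_sign_def minus_one_power_iff)
  have "(\<Prod>i<m. ribbon_sign (f i)) \<in> {1, -1}" for m and f :: "nat \<Rightarrow> (nat \<times> nat) set"
    by (induction m) (use sgn in \<open>force simp: lessThan_Suc\<close>)+
  then have "tableau_sign P \<in> {1, -1}" for P by (simp only: tableau_sign_def)
  from this[of "fst PQ"] this[of "snd PQ"] show ?thesis by (auto simp: pair_sign_def)
qed

theorem theorem10:
  fixes n l :: nat
  assumes "n > 0" and "l > 0"
  shows "\<exists>i \<phi>.
    signed_bijection (hook_perms n l) (\<lambda>_. 1) (tableau_pairs n l) pair_sign id i \<phi>
    \<and> (\<forall>P Q P1 Q1. (P, Q) \<in> tableau_pairs n l \<and> i (P, Q) = (P1, Q1) \<longrightarrow>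
          tableau_content P = tableau_content P1 \<and> tableau_content Q = tableau_content Q1)
    \<and> (\<forall>H \<sigma> P Q. (H, \<sigma>) \<in> hook_perms n l \<and> \<phi> (H, \<sigma>) = (P, Q) \<longrightarrow>
          hook_content H = tableau_content Q \<and> hook_perm_content H \<sigma> = tableau_content P)"
proof -
  \<comment> \<open>The components are ordered so that the content of \<open>P\<close> is compared
    with that of the hook permutation, and the content of \<open>Q\<close> with that of the hook
    sequence.\<close>
  define cA where "cA HS = (hook_perm_content (fst HS) (snd HS), hook_content (fst HS))"
    for HS :: "nat list list \<times> (nat \<Rightarrow> nat)"
  define cB where "cB PQ = (tableau_content (fst PQ), tableau_content (snd PQ))"
    for PQ :: "nat list list \<times> nat list list"
  have sum: "(\<Sum>PQ | PQ \<in> tableau_pairs n l \<and> cB PQ = c. pair_sign PQ)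
      = int (card {HS \<in> hook_perms n l. cA HS = c})" for c
    using sum_tableau_pairs_class[of n l "fst c" "snd c"] by (simp only: cA_def cB_def prod.collapse)
  obtain i \<phi> where inv: "sign_reversing_involution (tableau_pairs n l) pair_sign i"
    and bij: "bij_betw \<phi> (hook_perms n l) (Fix_on (tableau_pairs n l) i)"
    and sign: "\<forall>a\<in>hook_perms n l. pair_sign (\<phi> a) = 1"
    and ci: "\<forall>b\<in>tableau_pairs n l. cB (i b) = cB b"
    and c\<phi>: "\<forall>a\<in>hook_perms n l. cB (\<phi> a) = cA a"
    using classwise_cancelling_involution[where cA = cA and cB = cB, OF finite_hook_perms
        finite_tableau_pairs pair_sign_values sum] by blast
  have Fix_id: "Fix_on A id = A" for A :: "(nat list list \<times> (nat \<Rightarrow> nat)) set"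
    by (simp add: Fix_on_def)
  have "signed_bijection (hook_perms n l) (\<lambda>_. 1) (tableau_pairs n l) pair_sign id i \<phi>"
    unfolding signed_bijection_def signed_set_def Fix_id
    using finite_hook_perms finite_tableau_pairs pair_sign_values inv bij sign
    by (simp add: sign_reversing_involution_def Fix_id)
  moreover have "tableau_content P = tableau_content P1 \<and> tableau_content Q = tableau_content Q1"
    if "(P, Q) \<in> tableau_pairs n l" "i (P, Q) = (P1, Q1)" for P Q P1 Q1
    using bspec[OF ci that(1)] that(2) by (simp add: cB_def)
  moreover have "hook_content H = tableau_content Q \<and> hook_perm_content H \<sigma> = tableau_content P"
    if "(H, \<sigma>) \<in> hook_perms n l" "\<phi> (H, \<sigma>) = (P, Q)" for H \<sigma> P Q
    using bspec[OF c\<phi> that(1)] that(2) by (simp add: cA_def cB_def)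
  ultimately show ?thesis by blast
qed

end
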